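(* Let $2<\alpha\le 3$, $\beta\ge 0$, $0<\eta\le 1$, and let $\varphi:[0,1]\to[0,1]$ be a strictly increasing function of class $C^{n}$, $n=[\alpha]+1$, with $\varphi'(x)\neq 0$ for all $x\in[0,1]$. Put $\Phi(t)=\varphi(t)-\varphi(0)$ and $\mu=(\alpha-1)\varphi'(1)[\Phi(1)]^{\alpha-2}-\beta[\Phi(\eta)]^{\alpha-1}$. Let $f:[0,1]\times\mathbb{R}\to\mathbb{R}$ be continuous, and suppose there exists a continuous function $g:[0,1]\to[0,\infty)$, not identically zero, such that $$|f(t,u)-f(t,v)|\le g(t)\,|u-v|\qquad\text{for all } t\in[0,1],\ u,v\in\mathbb{R}.$$ If $$\|g\|_\infty<\frac{\mu\,\Gamma(\alpha)}{\sqrt{2}\,[\Phi(1)]^{\alpha-1}\varphi'(1)},$$ then the fractional boundary value problem $$D^{\alpha,\varphi}u(t)+f(t,u(t))=0,\quad t\in(0,1),\qquad u(0)=u'(0)=0,\quad u'(1)=\beta u(\eta),$$ has a unique solution on $[0,1]$.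
   Context: $[\alpha]$ denotes the integer part of $\alpha$ and $\|g\|_\infty=\sup_{t\in[0,1]}|g(t)|$. For $\gamma>0$ the $\varphi$-Riemann–Liouville fractional integral (based at $0$) is $$I^{\gamma,\varphi}u(t)=\frac{1}{\Gamma(\gamma)}\int_0^t\varphi'(s)(\varphi(t)-\varphi(s))^{\gamma-1}u(s)\,ds,$$ and the $\varphi$-Riemann–Liouville fractional derivative of order $\alpha$, with $n=[\alpha]+1$, is $$D^{\alpha,\varphi}u(t)=\Big(\frac{1}{\varphi'(t)}\frac{d}{dt}\Big)^{n}I^{n-\alpha,\varphi}u(t).$$ A solution is a function $u\in C([0,1],\mathbb{R})$ satisfying the differential equation on $(0,1)$ and the boundary conditions (the derivatives occurring in them being assumed to exist). *)

theory Defs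
  imports "HOL-Analysis.Analysis"
begin

text \<open>Functions on the unit interval are represented by total functions on the reals of which only the
  values on \<open>{0..1}\<close> matter. All derivatives are therefore taken within \<open>{0..1}\<close>: they are the
  ordinary ones in the interior and one-sided at the endpoints.\<close>

definition deriv01 :: "(real \<Rightarrow> real) \<Rightarrow> real \<Rightarrow> real" where
  "deriv01 f t = vector_derivative f (at t within {0..1})"

definition C_class01 :: "nat \<Rightarrow> (real \<Rightarrow> real) \<Rightarrow> bool" where
  "C_class01 n f \<longleftrightarrow>
     (\<forall>k<n. (deriv01 ^^ k) f differentiable_on {0..1}) \<and>
     (\<forall>k\<le>n. continuous_on {0..1} ((deriv01 ^^ k) f))"

definition frac_order :: "real \<Rightarrow> nat" where
  "frac_order \<alpha> = nat \<lfloor>\<alpha>\<rfloor> + 1"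

definition phi_RL_integral :: "real \<Rightarrow> (real \<Rightarrow> real) \<Rightarrow> (real \<Rightarrow> real) \<Rightarrow> real \<Rightarrow> real" where
  "phi_RL_integral \<gamma> \<phi> u t =
     1 / Gamma \<gamma> * integral {0..t} (\<lambda>s. deriv01 \<phi> s * (\<phi> t - \<phi> s) powr (\<gamma> - 1) * u s)"

definition phi_diff_op :: "(real \<Rightarrow> real) \<Rightarrow> (real \<Rightarrow> real) \<Rightarrow> real \<Rightarrow> real" where
  "phi_diff_op \<phi> F t = 1 / deriv01 \<phi> t * deriv01 F t"

definition phi_RL_deriv :: "real \<Rightarrow> (real \<Rightarrow> real) \<Rightarrow> (real \<Rightarrow> real) \<Rightarrow> real \<Rightarrow> real" where
  "phi_RL_deriv \<alpha> \<phi> u =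
     (phi_diff_op \<phi> ^^ frac_order \<alpha>) (phi_RL_integral (real (frac_order \<alpha>) - \<alpha>) \<phi> u)"

text \<open>\<open>phi_RL_deriv\<close> is total, with unspecified values where a derivative fails to exist. The next
  predicate says that every differentiation performed in \<open>phi_RL_deriv\<close> is legitimate throughout
  the open interval.\<close>

definition phi_RL_differentiable :: "real \<Rightarrow> (real \<Rightarrow> real) \<Rightarrow> (real \<Rightarrow> real) \<Rightarrow> bool" where
  "phi_RL_differentiable \<alpha> \<phi> u \<longleftrightarrow>
     (\<forall>k < frac_order \<alpha>. \<forall>t\<in>{0<..<1}.
        (phi_diff_op \<phi> ^^ k) (phi_RL_integral (real (frac_order \<alpha>) - \<alpha>) \<phi> u)
          differentiable (at t within {0..1}))"

definition sup_norm01 :: "(real \<Rightarrow> real) \<Rightarrow> real" where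
  "sup_norm01 g = (SUP t\<in>{0..1}. \<bar>g t\<bar>)"

definition Phi :: "(real \<Rightarrow> real) \<Rightarrow> real \<Rightarrow> real" where
  "Phi \<phi> t = \<phi> t - \<phi> 0"

definition mu_const :: "real \<Rightarrow> real \<Rightarrow> real \<Rightarrow> (real \<Rightarrow> real) \<Rightarrow> real" where
  "mu_const \<alpha> \<beta> \<eta> \<phi> =
     (\<alpha> - 1) * deriv01 \<phi> 1 * Phi \<phi> 1 powr (\<alpha> - 2) - \<beta> * Phi \<phi> \<eta> powr (\<alpha> - 1)"

definition bvp_solution ::
  "real \<Rightarrow> real \<Rightarrow> real \<Rightarrow> (real \<Rightarrow> real) \<Rightarrow> (real \<Rightarrow> real \<Rightarrow> real) \<Rightarrow> (real \<Rightarrow> real) \<Rightarrow> bool" where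
  "bvp_solution \<alpha> \<beta> \<eta> \<phi> f u \<longleftrightarrow>
     continuous_on {0..1} u \<and>
     phi_RL_differentiable \<alpha> \<phi> u \<and>
     (\<forall>t\<in>{0<..<1}. phi_RL_deriv \<alpha> \<phi> u t + f t (u t) = 0) \<and>
     u 0 = 0 \<and>
     (u has_real_derivative 0) (at 0 within {0..1}) \<and>
     (u has_real_derivative \<beta> * u \<eta>) (at 1 within {0..1})"

end

theory Submission
  imports Defs
begin

text \<open>The substitution \<open>x = \<Phi>(t)\<close> turns the \<open>\<phi>\<close>-integral into the classical Riemann-Liouville integral and
  the operator \<open>(1/\<phi>') d/dt\<close> into \<open>d/dx\<close>, so the problem on \<open>[0, 1]\<close> is equivalent to a classical one on
  \<open>[0, L]\<close> with \<open>L = \<Phi>(1) \<le> 1\<close> (lemma \<open>bvp_solution_iff_rl_bvp\<close>).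

  For a prescribed function \<open>h\<close> in the place of \<open>f(x, v(x))\<close> the classical problem can be solved in closed form. By the semigroup
  law \<open>rl_integral_semigroup\<close>, adding the integral of \<open>h\<close> of order \<open>\<alpha>\<close> to a solution \<open>v\<close> gives a function whose
  integral of order \<open>n - \<alpha>\<close> is a polynomial of degree below \<open>n\<close>. The conditions at \<open>0\<close> annihilate all its
  coefficients except the leading one, and the condition at \<open>L\<close> fixes that one. Hence \<open>v\<close> solves the
  problem iff \<open>v(x) = c x^(\<alpha>-1) - (I^\<alpha> h)(x)\<close> with an explicit constant \<open>c\<close> that depends linearly on \<open>h\<close>
  and has \<open>\<mu>\<close> as its denominator (lemmas \<open>rl_bvp_imp_green\<close> and \<open>green_imp_rl_bvp\<close>). The solutions of
  the nonlinear problem are therefore the fixed points of the map that sends \<open>v\<close> to the solution for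
  \<open>h(x) = f(x, v(x))\<close>.

  This map is a contraction for the supremum norm. The Green function is nonnegative when \<open>\<mu> > 0\<close>
  (lemma \<open>green_kernel_nonneg\<close>), so the operator norm is attained at \<open>h = 1\<close> and is at most
  \<open>\<phi>'(1) L^(2\<alpha>-2) / (\<mu> \<Gamma>(\<alpha>))\<close> (lemma \<open>green_abs_le\<close>). Multiplied by the bound on \<open>g\<close> this is less than
  \<open>L^(\<alpha>-1) / sqrt 2\<close>, hence less than \<open>1\<close>, and Banach's fixed point theorem applies.\<close>

section \<open>The Riemann-Liouville integral\<close>

text \<open>The classical Riemann-Liouville integral of order \<open>a\<close> based at \<open>0\<close>, i.e. the case
  \<open>\<phi> = id\<close> of the integral in the problem.\<close>

definition rl_integral :: "real \<Rightarrow> (real \<Rightarrow> real) \<Rightarrow> real \<Rightarrow> real" where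
  "rl_integral a z x = 1 / Gamma a * integral {0..x} (\<lambda>s. (x - s) powr (a - 1) * z s)"

text \<open>Euler's Beta integral, moved from \<open>[0, 1]\<close> to \<open>[s, x]\<close>.\<close>

lemma beta_kernel_has_integral:
  fixes a b s x :: real
  assumes "a > 0" "b > 0" "s < x"
  shows "((\<lambda>y. (x - y) powr (a - 1) * (y - s) powr (b - 1)) has_integral
           Beta a b * (x - s) powr (a + b - 1)) {s..x}"
proof -
  let ?l = "x - s"
  have l: "?l > 0" using assms by simp
  have "((\<lambda>t. t powr (b - 1) * (1 - t) powr (a - 1)) has_integral Beta b a) (cbox 0 1)"
    using has_integral_Beta_real[of b a] assms by simp
  from has_integral_affinity'[OF this, of "1 / ?l" "- s / ?l"] l
  have "((\<lambda>y. ((y - s) / ?l) powr (b - 1) * (1 - (y - s) / ?l) powr (a - 1)) has_integral Beta b a * ?l)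
      (cbox ((0 - - s / ?l) /\<^sub>R (1 / ?l)) ((1 - - s / ?l) /\<^sub>R (1 / ?l)))"
    by (simp add: diff_divide_distrib mult.commute)
  moreover have "(0 - - s / ?l) /\<^sub>R (1 / ?l) = s" "(1 - - s / ?l) /\<^sub>R (1 / ?l) = x"
    using l by (simp_all add: field_simps)
  ultimately have "((\<lambda>y. ((y - s) / ?l) powr (b - 1) * (1 - (y - s) / ?l) powr (a - 1)) has_integral Beta b a * ?l) {s..x}"
    by simp
  from has_integral_mult_right[OF this, of "?l powr (a + b - 2)"]
  have *: "((\<lambda>y. ?l powr (a + b - 2) * (((y - s) / ?l) powr (b - 1) * (1 - (y - s) / ?l) powr (a - 1)))
      has_integral ?l powr (a + b - 2) * (Beta b a * ?l)) {s..x}" .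
  have e1: "?l powr (a + b - 2) * (Beta b a * ?l) = Beta a b * ?l powr (a + b - 1)"
    using powr_add[of ?l "a + b - 2" 1] l by (simp add: Beta_commute)
  have e2: "?l powr (a + b - 2) * (((y - s) / ?l) powr (b - 1) * (1 - (y - s) / ?l) powr (a - 1))
      = (x - y) powr (a - 1) * (y - s) powr (b - 1)" if "y \<in> {s..x}" for y
  proof -
    have "1 - (y - s) / ?l = (x - y) / ?l" using l by (simp add: field_simps)
    moreover have "?l powr (a + b - 2) = ?l powr (b - 1) * ?l powr (a - 1)"
      using l by (simp add: add.commute flip: powr_add)
    ultimately show ?thesis using l that by (simp add: powr_divide)
  qed
  show ?thesis
    using has_integral_eq[OF e2 *] unfolding e1 by simp
qed

lemma power_kernel_has_integral:
  fixes a s x :: real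
  assumes "a > 0" "s \<le> x"
  shows "((\<lambda>y. (x - y) powr (a - 1)) has_integral (x - s) powr a / a) {s..x}"
proof -
  have "((\<lambda>t. t powr (a - 1)) has_integral (x - s) powr a / a) (cbox 0 (x - s))"
    using has_integral_powr_from_0[of "a - 1" "x - s"] assms by simp
  then have "((\<lambda>y. (y + x) powr (a - 1)) has_integral (x - s) powr a / a) {- x..- s}"
    using has_integral_affinity'[of "\<lambda>t. t powr (a - 1)" _ 0 "x - s" 1 x] by simp
  then show ?thesis
    using has_integral_reflect_real[where f = "\<lambda>y. (x - y) powr (a - 1)" and a = s and b = x] assms
    by (simp add: add.commute)
qed

lemma rl_integrand_absolutely_integrable:
  fixes a x :: real
  assumes a: "a > 0" and z: "continuous_on {0..x} z"
  shows "(\<lambda>s. (x - s) powr (a - 1) * z s) absolutely_integrable_on {0..x}"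
proof (cases "0 \<le> x")
  case True
  have "(\<lambda>y. (x - y) powr (a - 1)) absolutely_integrable_on {0..x}"
    using power_kernel_has_integral[OF a True]
    by (intro nonnegative_absolutely_integrable_1) (auto intro: has_integral_integrable)
  moreover have "z \<in> borel_measurable (lebesgue_on {0..x})"
    by (intro continuous_imp_measurable_on_sets_lebesgue z) auto
  moreover have "bounded (z ` {0..x})"
    by (intro compact_imp_bounded compact_continuous_image z) auto
  ultimately have "(\<lambda>s. z s * (x - s) powr (a - 1)) absolutely_integrable_on {0..x}"
    by (intro absolutely_integrable_bounded_measurable_product_real) auto
  then show ?thesis by (simp add: mult.commute)
qed (auto simp: absolutely_integrable_on_def)

lemma rl_integrand_integrable:
  fixes a x :: real
  assumes "a > 0" "continuous_on {0..x} z"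
  shows "(\<lambda>s. (x - s) powr (a - 1) * z s) integrable_on {0..x}"
  using rl_integrand_absolutely_integrable[OF assms] set_lebesgue_integral_eq_integral(1) by blast

lemma rl_add:
  assumes "a > 0" "continuous_on {0..x} z" "continuous_on {0..x} w"
  shows "rl_integral a (\<lambda>s. z s + w s) x = rl_integral a z x + rl_integral a w x"
  using integral_add[OF rl_integrand_integrable[OF assms(1,2)] rl_integrand_integrable[OF assms(1,3)]]
  by (simp add: rl_integral_def algebra_simps add_divide_distrib)

lemma rl_cmult: "rl_integral a (\<lambda>s. c * z s) x = c * rl_integral a z x"
  using integral_mult_right[of "{0..x}" c "\<lambda>s. (x - s) powr (a - 1) * z s"]
  by (simp add: rl_integral_def algebra_simps del: integral_mult_right)

lemma rl_cong: "(\<And>s. s \<in> {0..x} \<Longrightarrow> z s = w s) \<Longrightarrow> rl_integral a z x = rl_integral a w x"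
  unfolding rl_integral_def by (intro arg_cong2[where f = "(*)"] refl integral_cong) auto

lemma rl_const:
  assumes "a > 0" "0 \<le> x"
  shows "rl_integral a (\<lambda>_. 1) x = x powr a / Gamma (a + 1)"
  using integral_unique[OF power_kernel_has_integral[OF assms]] assms Gamma_plus1[of a]
  by (simp add: rl_integral_def nonpos_Ints_def)

lemma rl_abs_le:
  assumes a: "a > 0" and x: "0 \<le> x" and z: "continuous_on {0..x} z"
    and M: "\<And>s. s \<in> {0..x} \<Longrightarrow> \<bar>z s\<bar> \<le> M"
  shows "\<bar>rl_integral a z x\<bar> \<le> M * x powr a / Gamma (a + 1)"
proof -
  have "\<bar>integral {0..x} (\<lambda>s. (x - s) powr (a - 1) * z s)\<bar>
     \<le> integral {0..x} (\<lambda>s. (x - s) powr (a - 1) * M)"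
    using integral_norm_bound_integral[OF rl_integrand_integrable[OF a z]
      rl_integrand_integrable[OF a continuous_on_const]] M
    by (auto simp: abs_mult mult_left_mono)
  then have "\<bar>rl_integral a z x\<bar> \<le> rl_integral a (\<lambda>_. M * 1) x"
    using Gamma_real_pos[OF a] by (simp add: rl_integral_def abs_mult divide_right_mono)
  also have "\<dots> = M * x powr a / Gamma (a + 1)"
    unfolding rl_cmult using rl_const[OF a x] by simp
  finally show ?thesis .
qed

text \<open>The integrals of the statement are gauge integrals, whereas Fubini's theorem is about Lebesgue
  integrals. This lemma and the next one translate between the two, for a singular nonnegative kernel and
  for a function that is cut off outside an interval.\<close>

lemma has_bochner_integral_if_nonneg_has_integral:
  fixes f :: "real \<Rightarrow> real"
  assumes "f \<in> borel_measurable borel" "\<And>x. 0 \<le> f x" "(f has_integral I) UNIV"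
  shows "has_bochner_integral lborel f I"
  using assms nn_integral_has_integral_lborel[OF assms] has_integral_nonneg[OF assms(3)]
  by (intro has_bochner_integral_nn_integral) auto

lemma has_integral_if_integrable_lborel:
  fixes F f :: "real \<Rightarrow> real"
  assumes F: "integrable lborel F"
    and eq: "\<And>y. 0 < y \<Longrightarrow> y < x \<Longrightarrow> f y = F y"
    and zero: "\<And>y. y \<le> 0 \<or> x \<le> y \<Longrightarrow> F y = 0"
  shows "(f has_integral (\<integral>y. F y \<partial>lborel)) {0..x}"
proof -
  have "(F has_integral (\<integral>y. F y \<partial>lborel)) UNIV"
    using has_integral_integral_lborel[OF F] .
  then have "(F has_integral (\<integral>y. F y \<partial>lborel)) {0..x}"
    using has_integral_restrict_UNIV[of "{0..x}" F] zero
    by (smt (verit) atLeastAtMost_iff has_integral_cong)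
  then show ?thesis
    by (rule has_integral_spike[of "{0, x}", rotated 2]) (auto simp: eq)
qed

text \<open>The semigroup law. Exchanging the order of integration over the triangle \<open>0 < s < y < x\<close> leaves
  the inner integral \<open>\<integral> (x - y)^(a-1) (y - s)^(b-1) dy\<close> over \<open>[s, x]\<close>, which is a Beta integral and equals
  \<open>Beta a b (x - s)^(a+b-1)\<close>; the Gamma factors of the three integrals are exactly what cancels
  \<open>Beta a b\<close>. Fubini applies because the kernel is nonnegative with integrable marginal, and a function
  continuous on \<open>[0, x]\<close> is bounded.\<close>

theorem rl_integral_semigroup:
  assumes a: "a > 0" and b: "b > 0" and x: "0 \<le> x" and z: "continuous_on {0..x} z"
  shows "rl_integral a (rl_integral b z) x = rl_integral (a + b) z x"
proof (cases "x = 0")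
  case True then show ?thesis by (simp add: rl_integral_def)
next
  case False
  with x have x: "0 < x" by simp
  define zz where "zz = (\<lambda>s. indicator {0..x} s *\<^sub>R z s)"
  have [measurable]: "zz \<in> borel_measurable borel"
    unfolding zz_def by (intro borel_measurable_continuous_on_indicator z) auto
  obtain M where M: "\<And>s. s \<in> {0..x} \<Longrightarrow> \<bar>z s\<bar> \<le> M"
    using compact_imp_bounded[OF compact_continuous_image[OF z]] by (force simp: bounded_iff)
  \<comment> \<open>The kernel on the open triangle; the boundary, where the powers take default values, is a null set.\<close>
  define k where "k = (\<lambda>(s, y). if 0 < s \<and> s < y \<and> y < x then (x - y) powr (a - 1) * (y - s) powr (b - 1) else 0)"
  define K where "K = (\<lambda>(s, y). k (s, y) * zz s)"
  have km[measurable]: "k \<in> borel_measurable (lborel \<Otimes>\<^sub>M lborel)"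
    unfolding k_def by measurable
  have Km[measurable]: "K \<in> borel_measurable (lborel \<Otimes>\<^sub>M lborel)"
    unfolding K_def by measurable
  define B where "B = (\<lambda>s. if 0 < s \<and> s < x then Beta a b * (x - s) powr (a + b - 1) else 0)"
  have [measurable]: "B \<in> borel_measurable borel" unfolding B_def by measurable
  have kint: "has_bochner_integral lborel (\<lambda>y. k (s, y)) (B s)" for s
  proof (cases "0 < s \<and> s < x")
    case True
    have "((\<lambda>y. (x - y) powr (a - 1) * (y - s) powr (b - 1)) has_integral B s) {s..x}"
      using beta_kernel_has_integral[OF a b] True by (simp add: B_def)
    then have "((\<lambda>y. k (s, y)) has_integral B s) {s..x}"
      by (rule has_integral_spike[of "{s, x}", rotated 2]) (use True in \<open>auto simp: k_def\<close>)
    then have "((\<lambda>y. k (s, y)) has_integral B s) UNIV"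
      by (rule has_integral_on_superset) (auto simp: k_def)
    then show ?thesis
      by (intro has_bochner_integral_if_nonneg_has_integral) (auto simp: k_def)
  next
    case False
    then have "k (s, y) = 0" for y by (auto simp: k_def)
    with False show ?thesis by (auto simp: B_def)
  qed
  have Kint: "has_bochner_integral lborel (\<lambda>y. K (s, y)) (B s * zz s)" for s
    unfolding K_def using has_bochner_integral_mult_left[OF kint[of s]] by simp
  have Bpos: "B s \<ge> 0" for s
    using a b by (auto simp: B_def Beta_def intro!: mult_nonneg_nonneg divide_nonneg_nonneg Gamma_real_nonneg)
  have kpos: "k p \<ge> 0" for p by (auto simp: k_def split: prod.split)
  have Bz: "integrable lborel (\<lambda>s. B s * \<bar>zz s\<bar>)"
  proof -
    have "((\<lambda>y. (x - y) powr (a + b - 1)) has_integral x powr (a + b) / (a + b)) {0..x}"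
      using power_kernel_has_integral[of "a + b" 0 x] a b x by simp
    from has_integral_mult_right[OF this, of "Beta a b"]
    have "((\<lambda>y. Beta a b * (x - y) powr (a + b - 1)) has_integral Beta a b * (x powr (a + b) / (a + b))) {0..x}" .
    then have "(B has_integral Beta a b * (x powr (a + b) / (a + b))) {0..x}"
      by (rule has_integral_spike[of "{0, x}", rotated 2]) (auto simp: B_def)
    then have "(B has_integral Beta a b * (x powr (a + b) / (a + b))) UNIV"
      by (rule has_integral_on_superset) (auto simp: B_def)
    then have "integrable lborel B"
      using has_bochner_integral_if_nonneg_has_integral[of B] Bpos by (auto simp: has_bochner_integral_iff)
    then have "integrable lborel (\<lambda>s. M * B s)" by simp
    then show ?thesis
    proof (rule Bochner_Integration.integrable_bound)
      show "AE s in lborel. norm (B s * \<bar>zz s\<bar>) \<le> norm (M * B s)"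
      proof (rule AE_I2)
        fix s show "norm (B s * \<bar>zz s\<bar>) \<le> norm (M * B s)"
        proof (cases "s \<in> {0..x}")
          case True
          then have "\<bar>zz s\<bar> \<le> M" using M by (simp add: zz_def)
          then show ?thesis using Bpos[of s] by (simp add: abs_mult) (metis abs_ge_self mult.commute mult_right_mono order_trans)
        qed (auto simp: zz_def)
      qed
    qed simp
  qed
  have "integrable (lborel \<Otimes>\<^sub>M lborel) K"
  proof (rule lborel_pair.Fubini_integrable[OF Km])
    have "(\<integral>y. norm (K (s, y)) \<partial>lborel) = B s * \<bar>zz s\<bar>" for s
      using has_bochner_integral_mult_left[OF kint[of s], of "\<bar>zz s\<bar>"] kpos
      by (simp add: K_def abs_mult has_bochner_integral_iff)
    then show "integrable lborel (\<lambda>s. \<integral>y. norm (K (s, y)) \<partial>lborel)" using Bz by simp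
    show "AE s in lborel. integrable lborel (\<lambda>y. K (s, y))"
      using Kint by (auto simp: has_bochner_integral_iff)
  qed
  then have K': "integrable (lborel \<Otimes>\<^sub>M lborel) (case_prod (\<lambda>s y. K (s, y)))" by simp
  have int2: "integrable lborel (\<lambda>y. \<integral>s. K (s, y) \<partial>lborel)"
    using lborel_pair.integrable_snd[OF K'] .
  have int1: "integrable lborel (\<lambda>s. B s * zz s)"
    using lborel_pair.integrable_fst[OF K'] Kint by (simp add: has_bochner_integral_iff)
  have eq: "(\<integral>y. (\<integral>s. K (s, y) \<partial>lborel) \<partial>lborel) = (\<integral>s. B s * zz s \<partial>lborel)"
    using lborel_pair.Fubini_integral[OF K'] Kint by (simp add: has_bochner_integral_iff)
  have inner: "(x - y) powr (a - 1) * (Gamma b * rl_integral b z y) = (\<integral>s. K (s, y) \<partial>lborel)"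
    if y: "0 < y" "y < x" for y
  proof -
    have zy: "continuous_on {0..y} z" using z by (rule continuous_on_subset) (use y in auto)
    define h where "h = (\<lambda>s. if 0 < s \<and> s < y then (y - s) powr (b - 1) * zz s else 0)"
    have hm: "h \<in> borel_measurable borel" unfolding h_def by measurable
    have "h absolutely_integrable_on {0..y}"
      by (rule absolutely_integrable_spike[OF rl_integrand_absolutely_integrable[OF b zy], of "{0,y}"])
        (use y in \<open>auto simp: h_def zz_def\<close>)
    moreover have "(\<lambda>s. if s \<in> {0..y} then h s else 0) = h" by (auto simp: h_def)
    ultimately have "h absolutely_integrable_on UNIV"
      using absolutely_integrable_restrict_UNIV[of "{0..y}" h] by simp
    then have hi: "integrable lborel h"
      using hm by (simp add: set_integrable_def integrable_completion)
    have "((\<lambda>s. (y - s) powr (b - 1) * z s) has_integral (\<integral>s. h s \<partial>lborel)) {0..y}"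
      by (rule has_integral_if_integrable_lborel[OF hi]) (use y in \<open>auto simp: h_def zz_def\<close>)
    then have "Gamma b * rl_integral b z y = (\<integral>s. h s \<partial>lborel)"
      using Gamma_real_pos[OF b] by (simp add: rl_integral_def integral_unique)
    moreover have "K (s, y) = (x - y) powr (a - 1) * h s" for s
      using y by (auto simp: K_def k_def h_def)
    ultimately show ?thesis by simp
  qed
  have "((\<lambda>y. (x - y) powr (a - 1) * (Gamma b * rl_integral b z y)) has_integral
      (\<integral>y. (\<integral>s. K (s, y) \<partial>lborel) \<partial>lborel)) {0..x}"
  proof (rule has_integral_if_integrable_lborel[OF int2 inner])
    fix y assume "y \<le> 0 \<or> x \<le> y"
    then have "K (s, y) = 0" for s by (auto simp: K_def k_def)
    then show "(\<integral>s. K (s, y) \<partial>lborel) = 0" by simp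
  qed
  moreover have "((\<lambda>s. Beta a b * (x - s) powr (a + b - 1) * z s) has_integral
      (\<integral>s. B s * zz s \<partial>lborel)) {0..x}"
    by (rule has_integral_if_integrable_lborel[OF int1]) (auto simp: B_def zz_def)
  ultimately have "integral {0..x} (\<lambda>y. (x - y) powr (a - 1) * (Gamma b * rl_integral b z y))
     = integral {0..x} (\<lambda>s. Beta a b * (x - s) powr (a + b - 1) * z s)"
    using eq by (simp add: integral_unique)
  moreover have g: "Gamma a \<noteq> 0" "Gamma b \<noteq> 0" "Gamma (a + b) \<noteq> 0"
    using a b by (metis Gamma_real_pos add_pos_pos less_irrefl)+
  ultimately have "rl_integral a (\<lambda>y. Gamma b * rl_integral b z y) x * Gamma a = Beta a b * (Gamma (a + b) * rl_integral (a + b) z x)"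
    by (simp add: rl_integral_def[of a] rl_integral_def[of "a + b"] mult.assoc)
  then show ?thesis
    using g by (simp add: rl_cmult Beta_def field_simps)
qed

section \<open>Continuity, differentiation and injectivity\<close>

lemma rl_1: "rl_integral 1 z x = integral {0..x} z"
proof -
  \<comment> \<open>At \<open>s = x\<close> the kernel takes the value \<open>0 powr 0 = 0\<close> instead of \<open>1\<close>.\<close>
  have "integral {0..x} (\<lambda>s. (x - s) powr (1 - 1) * z s) = integral {0..x} z"
    by (rule integral_spike[of "{x}"]) auto
  then show ?thesis by (simp add: rl_integral_def)
qed

lemma rl_1_has_real_derivative:
  assumes "continuous_on {0..L} z" "x \<in> {0..L}"
  shows "(rl_integral 1 z has_real_derivative z x) (at x within {0..L})"
  using integral_has_real_derivative[OF assms] by (simp add: rl_1[abs_def])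

lemma Gamma_real_neq_0: "0 < a \<Longrightarrow> Gamma (a::real) \<noteq> 0"
  using Gamma_real_pos[of a] by linarith

lemma continuous_on_truncated_powr:
  fixes p :: real
  assumes "p > 0" "continuous_on S f"
  shows "continuous_on S (\<lambda>s. max 0 (f s) powr p)"
  using assms by (intro continuous_on_powr' continuous_intros) auto

text \<open>For \<open>a > 1\<close> the kernel vanishes continuously at \<open>s = x\<close>, so the variable upper limit can be traded for
  the truncated power \<open>max 0 (x - s)\<close> on the whole interval. This gives continuity in \<open>x\<close> and lets
  integrals with different upper limits be compared under one integral sign.\<close>

lemma rl_truncated_kernel:
  assumes a: "a > 1" and x: "x \<in> {0..L}" and z: "continuous_on {0..L} z"
  shows "((\<lambda>s. max 0 (x - s) powr (a - 1) * z s) has_integral Gamma a * rl_integral a z x) {0..L}"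
proof -
  have zx: "continuous_on {0..x} z" using z by (rule continuous_on_subset) (use x in auto)
  have "((\<lambda>s. (x - s) powr (a - 1) * z s) has_integral Gamma a * rl_integral a z x) {0..x}"
    using integrable_integral[OF rl_integrand_integrable[OF _ zx, of a]] a Gamma_real_neq_0[of a]
    by (simp add: rl_integral_def)
  then have "((\<lambda>s. max 0 (x - s) powr (a - 1) * z s) has_integral Gamma a * rl_integral a z x) {0..x}"
    by (rule has_integral_eq[rotated]) auto
  then have "((\<lambda>s. if s \<in> {0..x} then max 0 (x - s) powr (a - 1) * z s else 0)
      has_integral Gamma a * rl_integral a z x) {0..L}"
    by (subst has_integral_restrict) (use x in auto)
  then show ?thesis
    by (rule has_integral_eq[rotated]) auto
qed

lemma continuous_on_rl:
  assumes a: "a \<ge> 1" and z: "continuous_on {0..L} z"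
  shows "continuous_on {0..L} (rl_integral a z)"
proof (cases "a = 1")
  case True
  then show ?thesis
    using rl_1_has_real_derivative[OF z] by (auto intro!: DERIV_continuous_on[where D = z])
next
  case False
  with a have a: "a > 1" by simp
  have "continuous_on ({0..L} \<times> cbox 0 L) (\<lambda>(x, s). max 0 (x - s) powr (a - 1) * z s)"
    unfolding split_def using a
    by (intro continuous_intros continuous_on_truncated_powr continuous_on_compose2[OF z]) auto
  from integral_continuous_on_param[OF this]
  have "continuous_on {0..L} (\<lambda>x. integral {0..L} (\<lambda>s. max 0 (x - s) powr (a - 1) * z s))" by simp
  then have "continuous_on {0..L} (\<lambda>x. 1 / Gamma a * integral {0..L} (\<lambda>s. max 0 (x - s) powr (a - 1) * z s))"
    by (intro continuous_intros)
  then show ?thesis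
    using integral_unique[OF rl_truncated_kernel[OF a _ z]] Gamma_real_neq_0[of a] a
    by (auto elim!: continuous_on_eq)
qed

lemma rl_has_real_derivative:
  assumes a: "a \<ge> 1" and z: "continuous_on {0..L} z" and x: "x \<in> {0..L}"
  shows "(rl_integral (a + 1) z has_real_derivative rl_integral a z x) (at x within {0..L})"
proof -
  have "rl_integral (a + 1) z y = rl_integral 1 (rl_integral a z) y" if "y \<in> {0..L}" for y
    using rl_integral_semigroup[of 1 a y z] that a continuous_on_subset[OF z, of "{0..y}"] by (auto simp: add.commute)
  then show ?thesis
    using x by (intro has_field_derivative_transform_within[OF
      rl_1_has_real_derivative[OF continuous_on_rl[OF a z] x], of 1]) auto
qed

text \<open>A power is itself, up to a constant, a fractional integral of the function \<open>1\<close>, so the rule is an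
  instance of the semigroup law.\<close>

lemma rl_powr:
  assumes a: "a > 0" and b: "b > 0" and x: "0 \<le> x"
  shows "rl_integral a (\<lambda>s. s powr b) x = Gamma (b + 1) / Gamma (a + b + 1) * x powr (a + b)"
proof -
  have g: "Gamma (b + 1) \<noteq> 0" using b by (intro Gamma_real_neq_0) simp
  have "rl_integral a (\<lambda>s. s powr b) x = rl_integral a (\<lambda>s. Gamma (b + 1) * rl_integral b (\<lambda>_. 1) s) x"
    using b g by (intro rl_cong) (simp add: rl_const)
  also have "\<dots> = Gamma (b + 1) * rl_integral (a + b) (\<lambda>_. 1) x"
    unfolding rl_cmult using rl_integral_semigroup[OF a b x] by simp
  finally show ?thesis using rl_const[of "a + b" x] a b x by simp
qed

text \<open>Integrating the hypothesis to order \<open>2 - c\<close> turns it, by the semigroup law, into the vanishing of the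
  double integral of \<open>z\<close>, and two ordinary differentiations recover \<open>z\<close>.\<close>

lemma rl_eq_0_imp_eq_0:
  assumes c: "0 < c" "c \<le> 1" and z: "continuous_on {0..L} z"
    and zero: "\<And>x. 0 < x \<Longrightarrow> x < L \<Longrightarrow> rl_integral c z x = 0" and x: "0 < x" "x < L"
  shows "z x = 0"
proof -
  have zy: "continuous_on {0..y} z" if "y \<in> {0<..<L}" for y
    using z by (rule continuous_on_subset) (use that in auto)
  have rl2: "rl_integral (1 + 1) z y = 0" if y: "y \<in> {0<..<L}" for y
  proof -
    have "rl_integral (1 + 1) z y = rl_integral (2 - c) (rl_integral c z) y"
      using rl_integral_semigroup[of "2 - c" c y z] y c zy[OF y] by simp
    also have "\<dots> = rl_integral (2 - c) (\<lambda>_. 0 * 0) y"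
    proof (rule rl_cong)
      fix s assume "s \<in> {0..y}"
      then show "rl_integral c z s = 0 * 0"
        using y zero[of s] by (cases "s = 0") (auto simp: rl_integral_def[of c])
    qed
    finally show ?thesis unfolding rl_cmult by simp
  qed
  have o: "open {0<..<L}" by simp
  have within: "(f has_real_derivative D) (at y)"
    if "(f has_real_derivative D) (at y within {0..L})" "y \<in> {0<..<L}" for f D y
    using that by (simp add: at_within_Icc_at)
  have rl1: "rl_integral 1 z y = 0" if y: "y \<in> {0<..<L}" for y
  proof -
    have "(rl_integral (1 + 1) z has_real_derivative rl_integral 1 z y) (at y)"
      using y by (intro within rl_has_real_derivative z) auto
    moreover have "(rl_integral (1 + 1) z has_real_derivative 0) (at y)"
      by (rule has_field_derivative_transform_within_open[OF DERIV_const o y]) (simp only: rl2)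
    ultimately show ?thesis by (rule DERIV_unique)
  qed
  have xx: "x \<in> {0<..<L}" using x by simp
  have "(rl_integral 1 z has_real_derivative z x) (at x)"
    using xx by (intro within rl_1_has_real_derivative z) auto
  moreover have "(rl_integral 1 z has_real_derivative 0) (at x)"
    by (rule has_field_derivative_transform_within_open[OF DERIV_const o xx]) (simp only: rl1)
  ultimately show ?thesis by (rule DERIV_unique)
qed

section \<open>Polynomials and iterated derivatives\<close>

text \<open>The order of vanishing at \<open>0\<close> exceeds \<open>m\<close>, so only the top coefficient can survive.\<close>

lemma poly_little_o_imp_monomial:
  fixes p :: "real poly"
  assumes deg: "degree p \<le> Suc m"
    and small: "((\<lambda>x. poly p x / x ^ m) \<longlongrightarrow> 0) (at_right 0)"
  shows "\<exists>a. \<forall>x. poly p x = a * x ^ Suc m"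
proof (cases "p = 0")
  case False
  define k where "k = order 0 p"
  obtain q where q: "p = [:- 0, 1:] ^ k * q" "\<not> [:- 0, 1:] dvd q"
    using order_decomp[OF False, of 0] unfolding k_def by blast
  have pq: "poly p x = x ^ k * poly q x" for x by (simp add: q(1))
  have q0: "poly q 0 \<noteq> 0" using q(2) by (simp add: poly_eq_0_iff_dvd)
  have lim: "(poly q \<longlongrightarrow> poly q 0) (at_right 0)"
    by (rule filterlim_mono[of "poly q" _ "at 0"]) (auto simp: at_le intro: isContD DERIV_isCont[OF poly_DERIV])
  have "k > m"
  proof (rule ccontr)
    assume "\<not> k > m"
    then have km: "k \<le> m" by simp
    have "((\<lambda>x. x ^ (m - k) * (poly p x / x ^ m)) \<longlongrightarrow> 0 ^ (m - k) * 0) (at_right 0)"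
      by (intro tendsto_intros small)
    moreover have "\<forall>\<^sub>F x in at_right 0. x ^ (m - k) * (poly p x / x ^ m) = poly q x"
      unfolding pq using eventually_at_right_less[of 0]
      by eventually_elim (use km in \<open>simp add: power_diff\<close>)
    ultimately have "(poly q \<longlongrightarrow> 0) (at_right 0)"
      by (simp add: tendsto_cong)
    then show False using tendsto_unique[OF _ lim] q0 by auto
  qed
  have "q \<noteq> 0" using q0 by auto
  then have "degree p = k + degree q"
    by (subst q(1), subst degree_mult_eq) (auto simp: degree_power_eq)
  with deg \<open>k > m\<close> have "k = Suc m" "degree q = 0" by auto
  moreover obtain a where "q = [:a:]" using \<open>degree q = 0\<close> by (rule degree_eq_zeroE)
  ultimately show ?thesis using pq by auto
qed auto

text \<open>Taylor's formula about the midpoint has zero remainder.\<close>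

lemma iterated_derivative_zero_imp_poly:
  fixes F :: "nat \<Rightarrow> real \<Rightarrow> real"
  assumes deriv: "\<And>k x. k \<le> m \<Longrightarrow> x \<in> {0<..<L} \<Longrightarrow> (F k has_real_derivative F (Suc k) x) (at x)"
    and zero: "\<And>x. x \<in> {0<..<L} \<Longrightarrow> F (Suc m) x = 0"
  shows "\<exists>p. degree p \<le> m \<and> (\<forall>x\<in>{0<..<L}. F 0 x = poly p x)"
proof -
  define c where "c = L / 2"
  define p where "p = (\<Sum>k\<le>m. smult (F k c / fact k) ([:- c, 1:] ^ k))"
  have "degree p \<le> m"
    unfolding p_def
    by (intro degree_sum_le) (auto intro!: order_trans[OF degree_smult_le] order_trans[OF degree_power_le])
  moreover have "F 0 x = poly p x" if x: "x \<in> {0<..<L}" for x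
  proof -
    have px: "poly p x = (\<Sum>k<Suc m. F k c / fact k * (x - c) ^ k)"
      by (simp add: p_def poly_sum lessThan_Suc_atMost)
    show ?thesis
    proof (cases "x = c")
      case True
      then show ?thesis unfolding px by (simp add: lessThan_Suc_eq_insert_0 sum.reindex)
    next
      case False
      have "\<exists>t. (if x < c then x < t \<and> t < c else c < t \<and> t < x) \<and>
        F 0 x = (\<Sum>k<Suc m. F k c / fact k * (x - c) ^ k) + F (Suc m) t / fact (Suc m) * (x - c) ^ Suc m"
        by (rule Taylor[where a = "min x c" and b = "max x c" and f = "F 0" and diff = F])
          (use x False in \<open>auto intro!: deriv simp: c_def min_def max_def split: if_splits\<close>)
      then obtain t where t: "if x < c then x < t \<and> t < c else c < t \<and> t < x"
        and F: "F 0 x = (\<Sum>k<Suc m. F k c / fact k * (x - c) ^ k) + F (Suc m) t / fact (Suc m) * (x - c) ^ Suc m"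
        by blast
      have "F (Suc m) t = 0" using t x by (intro zero) (auto simp: c_def split: if_splits)
      then show ?thesis using F px by simp
    qed
  qed
  ultimately show ?thesis by blast
qed

section \<open>The linear problem\<close>

text \<open>The \<open>k\<close>-fold iterated integral. The case \<open>k = 0\<close> is separated because the formula for
  order \<open>0\<close> does not return the function itself.\<close>

definition rl_integral_nat :: "nat \<Rightarrow> (real \<Rightarrow> real) \<Rightarrow> real \<Rightarrow> real" where
  "rl_integral_nat k h = (if k = 0 then h else rl_integral (real k) h)"

lemma rl_integral_nat_has_real_derivative:
  assumes h: "continuous_on {0..L} h" and x: "x \<in> {0..L}"
  shows "(rl_integral_nat (Suc k) h has_real_derivative rl_integral_nat k h x) (at x within {0..L})"
  using rl_1_has_real_derivative[OF h x] rl_has_real_derivative[OF _ h x, of "real k"]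
  by (cases "k = 0") (auto simp: rl_integral_nat_def add.commute)

text \<open>The boundary value problem for \<open>D^\<alpha> v + h = 0\<close> on \<open>[0, L]\<close>, after the substitution
  \<open>x = \<Phi>(t)\<close>. The function \<open>W k\<close> is the \<open>k\<close>-th derivative of the integral of order \<open>n - \<alpha>\<close>; providing
  the whole chain of derivatives as a witness says at once that they exist and what the last one is.
  The constants \<open>d\<close> and \<open>e\<close> stand for \<open>\<phi>'(1)\<close> and \<open>\<Phi>(\<eta>)\<close>; the chain rule at \<open>t = 1\<close>
  produces the division by \<open>d\<close>.\<close>

definition rl_bvp :: "real \<Rightarrow> nat \<Rightarrow> real \<Rightarrow> real \<Rightarrow> real \<Rightarrow> real \<Rightarrow> (real \<Rightarrow> real) \<Rightarrow> (real \<Rightarrow> real) \<Rightarrow> bool" where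
  "rl_bvp \<alpha> n \<beta> d e L h v \<longleftrightarrow>
     continuous_on {0..L} v \<and>
     (\<exists>W. \<forall>x\<in>{0<..<L}. W 0 x = rl_integral (real n - \<alpha>) v x \<and> W n x = - h x \<and>
        (\<forall>k<n. (W k has_real_derivative W (Suc k) x) (at x))) \<and>
     v 0 = 0 \<and>
     (v has_real_derivative 0) (at 0 within {0..L}) \<and>
     (v has_real_derivative \<beta> * v e / d) (at L within {0..L})"

text \<open>The only candidate for a solution: minus the fractional integral of \<open>h\<close> of order \<open>\<alpha>\<close> plus the multiple of
  \<open>x^(\<alpha>-1)\<close> that the boundary condition at \<open>L\<close> dictates. Equivalently, the integral of \<open>h\<close> against the
  Green function of the problem.\<close>

definition green_solution :: "real \<Rightarrow> real \<Rightarrow> real \<Rightarrow> real \<Rightarrow> real \<Rightarrow> (real \<Rightarrow> real) \<Rightarrow> real \<Rightarrow> real" where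
  "green_solution \<alpha> \<beta> d e L h x =
     (d * rl_integral (\<alpha> - 1) h L - \<beta> * rl_integral \<alpha> h e) / ((\<alpha> - 1) * d * L powr (\<alpha> - 2) - \<beta> * e powr (\<alpha> - 1))
       * x powr (\<alpha> - 1) - rl_integral \<alpha> h x"

lemma powr_has_real_derivative_at_0:
  assumes "p > 1" "L > 0"
  shows "((\<lambda>x. x powr p) has_real_derivative 0) (at 0 within {0..L})"
proof -
  have "((\<lambda>x::real. x powr (p - 1)) \<longlongrightarrow> 0) (at_right 0)"
    using assms by (intro tendsto_zero_powrI[where b = "p - 1"]) (auto simp: eventually_at_right_less eventually_mono[OF eventually_at_right_less])
  moreover have "\<forall>\<^sub>F x in at_right (0::real). x powr (p - 1) = (x powr p - 0 powr p) / (x - 0)"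
    using eventually_at_right_less[of 0] by eventually_elim (simp add: powr_diff)
  ultimately have "((\<lambda>x::real. (x powr p - 0 powr p) / (x - 0)) \<longlongrightarrow> 0) (at_right 0)"
    by (simp add: tendsto_cong)
  then show ?thesis
    using assms by (simp add: has_field_derivative_iff at_within_Icc_at_right)
qed

lemma DERIV_unique_at_right_end:
  assumes "(f has_real_derivative D) (at L within {0..L})" "(f has_real_derivative E) (at L within {0..L})" "L > 0"
  shows "D = E"
  using assms tendsto_unique[OF trivial_limit_at_left_real]
  by (auto simp: has_field_derivative_iff at_within_Icc_at_left)

lemma pderiv_funpow_Suc_monom: "(pderiv ^^ Suc m) (monom (c::real) m) = 0"
proof (induction m arbitrary: c)
  case (Suc m)
  have "(pderiv ^^ Suc (Suc m)) (monom c (Suc m)) = (pderiv ^^ Suc m) (pderiv (monom c (Suc m)))"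
    by (subst funpow_Suc_right) simp
  then show ?case using Suc.IH by (simp add: pderiv_monom)
qed (simp add: pderiv_monom)

text \<open>The power \<open>x^(\<alpha>-1)\<close> has a multiple of \<open>x^m\<close> as its integral of order \<open>m + 1 - \<alpha>\<close>, so injectivity of
  that integral identifies \<open>y\<close>.\<close>

lemma rl_eq_monomial_imp_powr:
  fixes \<alpha> :: real
  assumes \<alpha>: "1 < \<alpha>" and n: "real (Suc m) - \<alpha> > 0" "real (Suc m) - \<alpha> \<le> 1" and L: "0 < L"
    and y: "continuous_on {0..L} y"
    and eq: "\<And>x. x \<in> {0<..<L} \<Longrightarrow> rl_integral (real (Suc m) - \<alpha>) y x = a * x ^ m"
  shows "\<exists>b. \<forall>x\<in>{0..L}. y x = b * x powr (\<alpha> - 1)"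
proof -
  define c where "c = real (Suc m) - \<alpha>"
  define K where "K = Gamma \<alpha> / Gamma (real (Suc m))"
  have K: "K \<noteq> 0" unfolding K_def
    using Gamma_real_neq_0[of \<alpha>] Gamma_real_neq_0[of "real (Suc m)"] \<alpha> by simp
  define w where "w = (\<lambda>x. y x + (- a / K) * x powr (\<alpha> - 1))"
  have pw: "continuous_on {0..x} (\<lambda>x. x powr (\<alpha> - 1))" for x :: real
    using \<alpha> by (intro continuous_on_powr' continuous_intros) auto
  have wc: "continuous_on {0..L} w"
    unfolding w_def by (intro continuous_intros y pw)
  have "rl_integral c w x = 0" if x: "0 < x" "x < L" for x
  proof -
    have yx: "continuous_on {0..x} y" using y by (rule continuous_on_subset) (use x in auto)
    have "rl_integral c w x = rl_integral c y x + rl_integral c (\<lambda>x. (- a / K) * x powr (\<alpha> - 1)) x"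
      unfolding w_def using n by (intro rl_add yx continuous_intros pw) (auto simp: c_def)
    also have "rl_integral c (\<lambda>x. (- a / K) * x powr (\<alpha> - 1)) x = (- a / K) * (K * x powr real m)"
      unfolding rl_cmult using rl_powr[of c "\<alpha> - 1" x] n \<alpha> x by (simp add: c_def K_def add.commute)
    also have "rl_integral c y x = a * x ^ m" using eq x by (simp add: c_def)
    finally show ?thesis using K x by (simp add: powr_realpow del: of_nat_Suc)
  qed
  then have "w x = 0" if "x \<in> {0<..<L}" for x
    using rl_eq_0_imp_eq_0[of c L w x] n wc that by (auto simp: c_def)
  then have "w x = 0" if "x \<in> {0..L}" for x
    using continuous_constant_on_closure[of "{0<..<L}" w 0 x] wc L that by auto
  then show ?thesis
    by (intro exI[of _ "a / K"]) (auto simp: w_def)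
qed

text \<open>A fractional integral of order \<open>c\<close> gains the factor \<open>x^c\<close>: from \<open>y = o(x)\<close> follows that its
  integral is \<open>o(x^(1+c))\<close>. This is how the two boundary conditions at \<open>0\<close> are used.\<close>

lemma rl_little_o_at_0:
  assumes c: "c > 0" and L: "L > 0" and y: "continuous_on {0..L} y"
    and y0: "y 0 = 0" "(y has_real_derivative 0) (at 0 within {0..L})"
    and m: "real m \<le> 1 + c"
  shows "((\<lambda>x. rl_integral c y x / x ^ m) \<longlongrightarrow> 0) (at_right 0)"
proof (rule tendstoI)
  fix \<epsilon> :: real assume \<epsilon>: "\<epsilon> > 0"
  \<comment> \<open>Chosen such that the bound for the integral comes out as half of \<open>\<epsilon> x^(1+c)\<close>.\<close>
  define \<delta> where "\<delta> = \<epsilon> * Gamma (c + 1) / 2"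
  have G: "Gamma (c + 1) > 0" using c by (intro Gamma_real_pos) simp
  have \<delta>: "\<delta> > 0" using \<epsilon> G by (simp add: \<delta>_def)
  have "((\<lambda>x. y x / x) \<longlongrightarrow> 0) (at_right 0)"
    using y0 L by (simp add: has_field_derivative_iff at_within_Icc_at_right)
  from tendstoD[OF this \<delta>] obtain b where b: "b > 0" "\<And>x. 0 < x \<Longrightarrow> x < b \<Longrightarrow> \<bar>y x / x\<bar> < \<delta>"
    by (auto simp: eventually_at_right[OF zero_less_one] dist_real_def)
  have "dist (rl_integral c y x / x ^ m) 0 < \<epsilon>" if x: "0 < x" "x < min b (min 1 L)" for x
  proof -
    have yx: "continuous_on {0..x} y" using y by (rule continuous_on_subset) (use x in auto)
    have "\<bar>y s\<bar> \<le> \<delta> * x" if s: "s \<in> {0..x}" for s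
    proof (cases "s = 0")
      case False
      then have "\<bar>y s\<bar> \<le> \<delta> * s" using b(2)[of s] s x by (simp add: field_simps)
      also have "\<dots> \<le> \<delta> * x" using s \<delta> by simp
      finally show ?thesis .
    qed (use y0 \<delta> x in auto)
    then have "\<bar>rl_integral c y x\<bar> \<le> \<delta> * x * x powr c / Gamma (c + 1)"
      using rl_abs_le[OF c _ yx, of "\<delta> * x"] x by auto
    also have "\<dots> = \<epsilon> / 2 * x powr (1 + c)"
      using G x by (simp add: \<delta>_def powr_add)
    also have "\<dots> \<le> \<epsilon> / 2 * x ^ m"
      using powr_mono'[OF m, of x] x \<epsilon> by (simp add: powr_realpow)
    finally have "\<bar>rl_integral c y x / x ^ m\<bar> \<le> \<epsilon> / 2" using x by (simp add: abs_mult field_simps)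
    moreover have "\<epsilon> / 2 < \<epsilon>" using \<epsilon> by simp
    ultimately show ?thesis unfolding dist_real_def by linarith
  qed
  then show "\<forall>\<^sub>F x in at_right 0. dist (rl_integral c y x / x ^ m) 0 < \<epsilon>"
    using b(1) L by (auto simp: eventually_at_right[OF zero_less_one] intro!: exI[of _ "min b (min 1 L)"])
qed

text \<open>The number \<open>n\<close> is the least integer above \<open>\<alpha>\<close>, so the order \<open>n - \<alpha>\<close> lies in \<open>(0, 1]\<close> and is \<open>1\<close> when \<open>\<alpha>\<close>
  is an integer.\<close>

context
  fixes \<alpha> \<beta> d e L \<mu> :: real and n :: nat
  assumes \<alpha>: "2 < \<alpha>" "\<alpha> \<le> 3" and n: "real n - 1 \<le> \<alpha>" "\<alpha> < real n"
    and L: "0 < L" and e: "0 < e" "e \<le> L" and d: "d > 0"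
    and \<mu>: "\<mu> = (\<alpha> - 1) * d * L powr (\<alpha> - 2) - \<beta> * e powr (\<alpha> - 1)"
begin

lemma powr_minus_rl_has_real_derivative:
  assumes h: "continuous_on {0..L} h"
    and v: "\<And>x. x \<in> {0..L} \<Longrightarrow> v x = b * x powr (\<alpha> - 1) - rl_integral \<alpha> h x"
  shows "(v has_real_derivative 0) (at 0 within {0..L})"
    and "(v has_real_derivative b * ((\<alpha> - 1) * L powr (\<alpha> - 2)) - rl_integral (\<alpha> - 1) h L) (at L within {0..L})"
proof -
  have r: "(rl_integral \<alpha> h has_real_derivative rl_integral (\<alpha> - 1) h x) (at x within {0..L})" if "x \<in> {0..L}" for x
    using rl_has_real_derivative[OF _ h that, of "\<alpha> - 1"] \<alpha> by simp
  have "((\<lambda>x. b * x powr (\<alpha> - 1) - rl_integral \<alpha> h x) has_real_derivative b * 0 - rl_integral (\<alpha> - 1) h 0) (at 0 within {0..L})"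
    using \<alpha> L by (intro DERIV_diff DERIV_cmult powr_has_real_derivative_at_0 r) auto
  moreover have "rl_integral (\<alpha> - 1) h 0 = 0" by (simp add: rl_integral_def)
  ultimately have "((\<lambda>x. b * x powr (\<alpha> - 1) - rl_integral \<alpha> h x) has_real_derivative 0) (at 0 within {0..L})"
    by simp
  then show "(v has_real_derivative 0) (at 0 within {0..L})"
    by (rule has_field_derivative_transform_within[OF _ zero_less_one]) (use L in \<open>simp_all add: v\<close>)
  have "((\<lambda>x. x powr (\<alpha> - 1)) has_real_derivative (\<alpha> - 1) * L powr (\<alpha> - 2)) (at L)"
    using has_real_derivative_powr[OF L, of "\<alpha> - 1"] by simp
  then have "((\<lambda>x. b * x powr (\<alpha> - 1) - rl_integral \<alpha> h x) has_real_derivative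
      b * ((\<alpha> - 1) * L powr (\<alpha> - 2)) - rl_integral (\<alpha> - 1) h L) (at L within {0..L})"
    using L by (intro DERIV_diff DERIV_cmult r) (auto intro: has_field_derivative_at_within)
  then show "(v has_real_derivative b * ((\<alpha> - 1) * L powr (\<alpha> - 2)) - rl_integral (\<alpha> - 1) h L) (at L within {0..L})"
    by (rule has_field_derivative_transform_within[OF _ zero_less_one]) (use L in \<open>simp_all add: v\<close>)
qed

text \<open>Put \<open>y = v + rl_integral \<alpha> h\<close>. By the semigroup law the integral \<open>F\<close> of \<open>y\<close> of order \<open>n - \<alpha>\<close> differs from
  that of \<open>v\<close> by the \<open>n\<close>-fold integral of \<open>h\<close>, so its \<open>n\<close>-th derivative vanishes and \<open>F\<close> is a
  polynomial of degree below \<open>n\<close>. The conditions at \<open>0\<close> make \<open>F = o(x^(1+n-\<alpha>))\<close>, and since \<open>\<alpha> \<le> 3\<close> this is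
  \<open>o(x^(n-2))\<close>. Only the monomial of degree \<open>n - 1\<close> is left, so that \<open>y\<close> is a multiple of \<open>x^(\<alpha>-1)\<close>; the
  condition at \<open>L\<close> determines the factor. Both \<open>n = 3\<close> and \<open>n = 4\<close> (the case \<open>\<alpha> = 3\<close>) are covered.\<close>

lemma rl_bvp_imp_green:
  assumes h: "continuous_on {0..L} h" and mu: "\<mu> \<noteq> 0"
    and sol: "rl_bvp \<alpha> n \<beta> d e L h v" and x: "x \<in> {0..L}"
  shows "v x = green_solution \<alpha> \<beta> d e L h x"
proof -
  from sol obtain W where v: "continuous_on {0..L} v"
    and W: "\<And>x. x \<in> {0<..<L} \<Longrightarrow> W 0 x = rl_integral (real n - \<alpha>) v x"
      "\<And>x. x \<in> {0<..<L} \<Longrightarrow> W n x = - h x"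
      "\<And>k x. x \<in> {0<..<L} \<Longrightarrow> k < n \<Longrightarrow> (W k has_real_derivative W (Suc k) x) (at x)"
    and bc: "v 0 = 0" "(v has_real_derivative 0) (at 0 within {0..L})"
      "(v has_real_derivative \<beta> * v e / d) (at L within {0..L})"
    unfolding rl_bvp_def by blast
  define m where "m = n - 2"
  have nm: "n = Suc (Suc m)" using n \<alpha> unfolding m_def by linarith
  define y where "y = (\<lambda>x. v x + rl_integral \<alpha> h x)"
  have rc: "continuous_on {0..L} (rl_integral \<alpha> h)" using \<alpha> h by (intro continuous_on_rl) auto
  have y: "continuous_on {0..L} y" unfolding y_def by (intro continuous_intros v rc)
  define F where "F = (\<lambda>k x. W k x + rl_integral_nat (n - k) h x)"
  have F0: "F 0 x = rl_integral (real n - \<alpha>) y x" if x: "x \<in> {0<..<L}" for x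
  proof -
    have sub: "continuous_on {0..x} f" if "continuous_on {0..L} f" for f :: "real \<Rightarrow> real"
      using that by (rule continuous_on_subset) (use x in auto)
    have "rl_integral (real n - \<alpha>) y x = rl_integral (real n - \<alpha>) v x + rl_integral (real n - \<alpha>) (rl_integral \<alpha> h) x"
      unfolding y_def using n by (intro rl_add sub v rc) auto
    also have "rl_integral (real n - \<alpha>) (rl_integral \<alpha> h) x = rl_integral (real n) h x"
      using rl_integral_semigroup[of "real n - \<alpha>" \<alpha> x h] n \<alpha> x sub[OF h] by simp
    finally show ?thesis using W(1)[OF x] nm by (simp add: F_def rl_integral_nat_def)
  qed
  have "\<exists>p. degree p \<le> Suc m \<and> (\<forall>x\<in>{0<..<L}. F 0 x = poly p x)"
  proof (rule iterated_derivative_zero_imp_poly)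
    fix k x assume k: "k \<le> Suc m" and x: "x \<in> {0<..<L}"
    have "(rl_integral_nat (Suc (Suc m - k)) h has_real_derivative rl_integral_nat (Suc m - k) h x) (at x)"
      using rl_integral_nat_has_real_derivative[OF h, of x "Suc m - k"] x by (simp add: at_within_Icc_at)
    moreover have "n - k = Suc (Suc m - k)" "n - Suc k = Suc m - k" using k nm by auto
    ultimately show "(F k has_real_derivative F (Suc k) x) (at x)"
      unfolding F_def using W(3)[OF x, of k] k nm by (auto intro!: DERIV_add)
  next
    fix x assume "x \<in> {0<..<L}"
    then show "F (Suc (Suc m)) x = 0"
      using W(2) by (simp add: F_def rl_integral_nat_def flip: nm)
  qed
  then obtain p where p: "degree p \<le> Suc m" "\<And>x. x \<in> {0<..<L} \<Longrightarrow> rl_integral (real n - \<alpha>) y x = poly p x"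
    using F0 by auto
  have y0: "y 0 = 0" using bc by (simp add: y_def rl_integral_def)
  have "(y has_real_derivative 0 + rl_integral (\<alpha> - 1) h 0) (at 0 within {0..L})"
    unfolding y_def using rl_has_real_derivative[OF _ h, of "\<alpha> - 1" 0] \<alpha> L
    by (intro DERIV_add bc) auto
  then have "(y has_real_derivative 0) (at 0 within {0..L})" by (simp add: rl_integral_def)
  then have "((\<lambda>x. rl_integral (real n - \<alpha>) y x / x ^ m) \<longlongrightarrow> 0) (at_right 0)"
    using n \<alpha> nm by (intro rl_little_o_at_0[OF _ L y y0]) auto
  moreover have "\<forall>\<^sub>F x in at_right 0. rl_integral (real n - \<alpha>) y x / x ^ m = poly p x / x ^ m"
    using L p(2) by (auto simp: eventually_at_right[OF zero_less_one] intro!: exI[of _ L])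
  ultimately have "((\<lambda>x. poly p x / x ^ m) \<longlongrightarrow> 0) (at_right 0)"
    by (simp add: tendsto_cong)
  then obtain a where a: "\<And>x. poly p x = a * x ^ Suc m"
    using poly_little_o_imp_monomial[OF p(1)] by blast
  have "\<exists>b. \<forall>x\<in>{0..L}. y x = b * x powr (\<alpha> - 1)"
    by (rule rl_eq_monomial_imp_powr[of _ "Suc m" _ _ a]) (use n \<alpha> L y p(2) a nm in auto)
  then obtain b where "\<And>x. x \<in> {0..L} \<Longrightarrow> y x = b * x powr (\<alpha> - 1)" by blast
  then have vb: "v x = b * x powr (\<alpha> - 1) - rl_integral \<alpha> h x" if "x \<in> {0..L}" for x
    using that by (simp add: y_def algebra_simps)
  have "\<beta> * v e / d = b * ((\<alpha> - 1) * L powr (\<alpha> - 2)) - rl_integral (\<alpha> - 1) h L"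
    using DERIV_unique_at_right_end[OF bc(3) powr_minus_rl_has_real_derivative(2)[OF h vb] L] .
  then have "b * \<mu> = d * rl_integral (\<alpha> - 1) h L - \<beta> * rl_integral \<alpha> h e"
    unfolding \<mu> using d vb[of e] e by (simp add: field_simps)
  then have "b = (d * rl_integral (\<alpha> - 1) h L - \<beta> * rl_integral \<alpha> h e) / \<mu>" using mu by (simp add: field_simps)
  then show ?thesis using vb[OF x] by (simp add: green_solution_def \<mu>)
qed

text \<open>The integral of order \<open>n - \<alpha>\<close> of the candidate is a multiple of \<open>x^(n-1)\<close> minus the \<open>n\<close>-fold integral
  of \<open>h\<close>, and this can be differentiated \<open>n\<close> times explicitly.\<close>

lemma green_imp_rl_bvp:
  assumes h: "continuous_on {0..L} h" and mu: "\<mu> \<noteq> 0"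
    and v: "\<And>x. x \<in> {0..L} \<Longrightarrow> v x = green_solution \<alpha> \<beta> d e L h x"
  shows "rl_bvp \<alpha> n \<beta> d e L h v"
proof -
  define c where "c = (d * rl_integral (\<alpha> - 1) h L - \<beta> * rl_integral \<alpha> h e) / \<mu>"
  have vc: "v x = c * x powr (\<alpha> - 1) - rl_integral \<alpha> h x" if "x \<in> {0..L}" for x
    using v[OF that] by (simp add: green_solution_def c_def \<mu>)
  have pw: "continuous_on {0..x} (\<lambda>x. x powr (\<alpha> - 1))" for x :: real
    using \<alpha> by (intro continuous_on_powr' continuous_intros) auto
  have rc: "continuous_on {0..L} (rl_integral \<alpha> h)" using \<alpha> h by (intro continuous_on_rl) auto
  have "continuous_on {0..L} (\<lambda>x. c * x powr (\<alpha> - 1) - rl_integral \<alpha> h x)"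
    by (intro continuous_intros pw rc)
  then have cont: "continuous_on {0..L} v" by (rule continuous_on_eq) (simp add: vc)
  have v0: "v 0 = 0" using vc[of 0] L by (simp add: rl_integral_def)
  have ve: "\<beta> * v e / d = c * ((\<alpha> - 1) * L powr (\<alpha> - 2)) - rl_integral (\<alpha> - 1) h L"
  proof -
    have "c * \<mu> = d * rl_integral (\<alpha> - 1) h L - \<beta> * rl_integral \<alpha> h e" using mu by (simp add: c_def)
    then have "\<beta> * (c * e powr (\<alpha> - 1) - rl_integral \<alpha> h e) = d * (c * ((\<alpha> - 1) * L powr (\<alpha> - 2)) - rl_integral (\<alpha> - 1) h L)"
      unfolding \<mu> by (simp add: algebra_simps)
    moreover have "v e = c * e powr (\<alpha> - 1) - rl_integral \<alpha> h e" using vc e by simp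
    ultimately show ?thesis using d by (simp add: nonzero_divide_eq_eq mult.commute)
  qed
  define m where "m = n - 1"
  have nm: "n = Suc m" using n \<alpha> unfolding m_def by linarith
  define K where "K = Gamma \<alpha> / Gamma (real n)"
  define W where "W = (\<lambda>k x. poly ((pderiv ^^ k) (monom (c * K) m)) x + - 1 * rl_integral_nat (n - k) h x)"
  have "W 0 x = rl_integral (real n - \<alpha>) v x \<and> W n x = - h x \<and>
        (\<forall>k<n. (W k has_real_derivative W (Suc k) x) (at x))" if x: "x \<in> {0<..<L}" for x
  proof (intro conjI allI impI)
    have sub: "continuous_on {0..x} f" if "continuous_on {0..L} f" for f :: "real \<Rightarrow> real"
      using that by (rule continuous_on_subset) (use x in auto)
    have "rl_integral (real n - \<alpha>) v x = rl_integral (real n - \<alpha>) (\<lambda>x. c * x powr (\<alpha> - 1) + - 1 * rl_integral \<alpha> h x) x"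
      using vc x by (intro rl_cong) auto
    also have "\<dots> = rl_integral (real n - \<alpha>) (\<lambda>x. c * x powr (\<alpha> - 1)) x + rl_integral (real n - \<alpha>) (\<lambda>x. - 1 * rl_integral \<alpha> h x) x"
      using n by (intro rl_add continuous_intros pw sub[OF rc]) auto
    also have "\<dots> = c * rl_integral (real n - \<alpha>) (\<lambda>x. x powr (\<alpha> - 1)) x + - 1 * rl_integral (real n - \<alpha>) (rl_integral \<alpha> h) x"
      by (simp only: rl_cmult)
    also have "rl_integral (real n - \<alpha>) (rl_integral \<alpha> h) x = rl_integral (real n) h x"
      using rl_integral_semigroup[of "real n - \<alpha>" \<alpha> x h] n \<alpha> x sub[OF h] by simp
    also have "rl_integral (real n - \<alpha>) (\<lambda>x. x powr (\<alpha> - 1)) x = K * x ^ m"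
      using rl_powr[of "real n - \<alpha>" "\<alpha> - 1" x] n \<alpha> x
      by (simp add: K_def nm add.commute powr_realpow)
    finally have "rl_integral (real n - \<alpha>) v x = c * (K * x ^ m) + - 1 * rl_integral (real n) h x" .
    moreover have "W 0 x = c * K * x ^ m + - 1 * rl_integral_nat n h x"
      by (simp add: W_def poly_monom)
    ultimately show "W 0 x = rl_integral (real n - \<alpha>) v x"
      using nm by (simp only: rl_integral_nat_def) simp
    show "W n x = - h x"
      unfolding W_def using pderiv_funpow_Suc_monom[of m "c * K"] nm
      by (simp add: rl_integral_nat_def del: funpow.simps)
    fix k assume k: "k < n"
    have "(rl_integral_nat (Suc (m - k)) h has_real_derivative rl_integral_nat (m - k) h x) (at x)"
      using rl_integral_nat_has_real_derivative[OF h, of x "m - k"] x by (simp add: at_within_Icc_at)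
    moreover have "n - k = Suc (m - k)" "n - Suc k = m - k" using k nm by auto
    moreover have "(poly ((pderiv ^^ k) (monom (c * K) m)) has_real_derivative
        poly ((pderiv ^^ Suc k) (monom (c * K) m)) x) (at x)"
      using poly_DERIV[of "(pderiv ^^ k) (monom (c * K) m)" x] by simp
    ultimately show "(W k has_real_derivative W (Suc k) x) (at x)"
      unfolding W_def by (intro DERIV_add DERIV_cmult) simp_all
  qed
  then have "\<exists>W. \<forall>x\<in>{0<..<L}. W 0 x = rl_integral (real n - \<alpha>) v x \<and> W n x = - h x \<and>
        (\<forall>k<n. (W k has_real_derivative W (Suc k) x) (at x))"
    by (intro exI[of _ W] ballI)
  with cont v0 powr_minus_rl_has_real_derivative[OF h vc] show ?thesis
    unfolding rl_bvp_def ve by (intro conjI)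
qed

section \<open>Positivity of the Green function and the contraction bound\<close>

text \<open>Let \<open>r = 1 - s / L\<close>. Every \<open>t\<close> in \<open>[0, L]\<close> satisfies \<open>max 0 (t - s) \<le> t r\<close>, with equality for
  \<open>t = L\<close>. Applied to \<open>t = e\<close> and \<open>t = x\<close>, and with \<open>r^(\<alpha>-1) \<le> r^(\<alpha>-2)\<close>, the expression is at least
  \<open>x^(\<alpha>-1) r^(\<alpha>-2)\<close> times \<open>(\<alpha>-1) d L^(\<alpha>-2) - \<beta> e^(\<alpha>-1) - \<mu> = 0\<close>.\<close>

lemma green_kernel_nonneg:
  assumes \<beta>: "\<beta> \<ge> 0" and mu: "\<mu> > 0" and s: "s \<in> {0..L}" and x: "x \<in> {0..L}"
  shows "0 \<le> x powr (\<alpha> - 1) * (d * (\<alpha> - 1) * max 0 (L - s) powr (\<alpha> - 2) - \<beta> * max 0 (e - s) powr (\<alpha> - 1))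
     - \<mu> * max 0 (x - s) powr (\<alpha> - 1)"
proof -
  define r where "r = 1 - s / L"
  have r: "0 \<le> r" "r \<le> 1" using s L by (auto simp: r_def field_simps)
  have *: "max 0 (t - s) powr (\<alpha> - 1) \<le> t powr (\<alpha> - 1) * r powr (\<alpha> - 2)" if t: "t \<in> {0..L}" for t
  proof -
    have "t * s / L \<le> s" using mult_right_mono[of t L s] t s L by (simp add: pos_divide_le_eq mult.commute)
    moreover have "t * r = t - t * s / L" by (simp add: r_def right_diff_distrib)
    moreover have "0 \<le> t * r" using t r(1) by simp
    ultimately have "max 0 (t - s) \<le> t * r" by linarith
    then have "max 0 (t - s) powr (\<alpha> - 1) \<le> (t * r) powr (\<alpha> - 1)"
      using \<alpha> by (intro powr_mono2) auto
    also have "\<dots> = t powr (\<alpha> - 1) * r powr (\<alpha> - 1)" using t r by (simp add: powr_mult)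
    also have "\<dots> \<le> t powr (\<alpha> - 1) * r powr (\<alpha> - 2)"
      using r by (intro mult_left_mono powr_mono') auto
    finally show ?thesis .
  qed
  have Ls: "max 0 (L - s) powr (\<alpha> - 2) = L powr (\<alpha> - 2) * r powr (\<alpha> - 2)"
  proof -
    have "max 0 (L - s) = L * r" using s L by (simp add: r_def field_simps)
    then show ?thesis using L r by (simp add: powr_mult)
  qed
  have "\<beta> * max 0 (e - s) powr (\<alpha> - 1) \<le> \<beta> * (e powr (\<alpha> - 1) * r powr (\<alpha> - 2))"
    using *[of e] e \<beta> by (intro mult_left_mono) auto
  then have "r powr (\<alpha> - 2) * \<mu> \<le> d * (\<alpha> - 1) * max 0 (L - s) powr (\<alpha> - 2) - \<beta> * max 0 (e - s) powr (\<alpha> - 1)"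
    unfolding Ls \<mu> by (simp add: algebra_simps)
  then have "x powr (\<alpha> - 1) * (r powr (\<alpha> - 2) * \<mu>) \<le> x powr (\<alpha> - 1) * (d * (\<alpha> - 1) * max 0 (L - s) powr (\<alpha> - 2) - \<beta> * max 0 (e - s) powr (\<alpha> - 1))"
    by (rule mult_left_mono) simp
  moreover have "\<mu> * max 0 (x - s) powr (\<alpha> - 1) \<le> \<mu> * (x powr (\<alpha> - 1) * r powr (\<alpha> - 2))"
    using *[OF x] mu by (intro mult_left_mono) auto
  ultimately show ?thesis by (simp add: mult_ac)
qed

lemma green_nonneg:
  assumes \<beta>: "\<beta> \<ge> 0" and mu: "\<mu> > 0" and x: "x \<in> {0..L}"
    and h: "continuous_on {0..L} h" "\<And>s. s \<in> {0..L} \<Longrightarrow> 0 \<le> h s"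
  shows "0 \<le> green_solution \<alpha> \<beta> d e L h x"
proof -
  have G: "Gamma \<alpha> = (\<alpha> - 1) * Gamma (\<alpha> - 1)"
  proof -
    have "\<alpha> - 1 \<notin> \<int>\<^sub>\<le>\<^sub>0" using nonpos_Ints_nonpos[of "\<alpha> - 1"] \<alpha> by auto
    then show ?thesis using Gamma_plus1[of "\<alpha> - 1"] by simp
  qed
  define P where "P = x powr (\<alpha> - 1)"
  have iL: "((\<lambda>s. max 0 (L - s) powr (\<alpha> - 2) * h s) has_integral Gamma (\<alpha> - 1) * rl_integral (\<alpha> - 1) h L) {0..L}"
    using rl_truncated_kernel[of "\<alpha> - 1" L L h] \<alpha> L h by simp
  have ie: "((\<lambda>s. max 0 (e - s) powr (\<alpha> - 1) * h s) has_integral Gamma \<alpha> * rl_integral \<alpha> h e) {0..L}"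
    using rl_truncated_kernel[of \<alpha> e L h] \<alpha> e h by simp
  have ix: "((\<lambda>s. max 0 (x - s) powr (\<alpha> - 1) * h s) has_integral Gamma \<alpha> * rl_integral \<alpha> h x) {0..L}"
    using rl_truncated_kernel[of \<alpha> x L h] \<alpha> x h by simp
  have "((\<lambda>s. P * (d * (\<alpha> - 1) * (max 0 (L - s) powr (\<alpha> - 2) * h s) - \<beta> * (max 0 (e - s) powr (\<alpha> - 1) * h s))
     - \<mu> * (max 0 (x - s) powr (\<alpha> - 1) * h s)) has_integral
     P * (d * (\<alpha> - 1) * (Gamma (\<alpha> - 1) * rl_integral (\<alpha> - 1) h L) - \<beta> * (Gamma \<alpha> * rl_integral \<alpha> h e)) - \<mu> * (Gamma \<alpha> * rl_integral \<alpha> h x)) {0..L}"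
    by (intro has_integral_diff has_integral_mult_right iL ie ix)
  then have "0 \<le> P * (d * (\<alpha> - 1) * (Gamma (\<alpha> - 1) * rl_integral (\<alpha> - 1) h L) - \<beta> * (Gamma \<alpha> * rl_integral \<alpha> h e)) - \<mu> * (Gamma \<alpha> * rl_integral \<alpha> h x)"
  proof (rule has_integral_nonneg)
    fix s assume s: "s \<in> {0..L}"
    from mult_nonneg_nonneg[OF green_kernel_nonneg[OF \<beta> mu s x] h(2)[OF s]]
    show "0 \<le> P * (d * (\<alpha> - 1) * (max 0 (L - s) powr (\<alpha> - 2) * h s) - \<beta> * (max 0 (e - s) powr (\<alpha> - 1) * h s))
     - \<mu> * (max 0 (x - s) powr (\<alpha> - 1) * h s)"
      unfolding P_def by (simp add: algebra_simps)
  qed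
  also have "\<dots> = (Gamma \<alpha> * \<mu>) * green_solution \<alpha> \<beta> d e L h x"
    using mu unfolding green_solution_def \<mu>[symmetric] P_def[symmetric] G by (simp add: field_simps)
  finally have "0 \<le> (Gamma \<alpha> * \<mu>) * green_solution \<alpha> \<beta> d e L h x" .
  moreover have "0 < Gamma \<alpha> * \<mu>" using mu \<alpha> by (intro mult_pos_pos Gamma_real_pos) auto
  ultimately show ?thesis
    using zero_le_mult_iff[of "Gamma \<alpha> * \<mu>" "green_solution \<alpha> \<beta> d e L h x"] by linarith
qed

lemma green_add:
  assumes "x \<in> {0..L}" "continuous_on {0..L} h" "continuous_on {0..L} k"
  shows "green_solution \<alpha> \<beta> d e L (\<lambda>s. h s + k s) x = green_solution \<alpha> \<beta> d e L h x + green_solution \<alpha> \<beta> d e L k x"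
proof -
  have "rl_integral a (\<lambda>s. h s + k s) y = rl_integral a h y + rl_integral a k y" if "a > 0" "y \<in> {0..L}" for a y
    using that by (intro rl_add continuous_on_subset[OF assms(2)] continuous_on_subset[OF assms(3)]) auto
  then show ?thesis
    using assms(1) \<alpha> L e by (simp add: green_solution_def add_divide_distrib diff_divide_distrib algebra_simps)
qed

lemma green_cmult: "green_solution \<alpha> \<beta> d e L (\<lambda>s. c * h s) x = c * green_solution \<alpha> \<beta> d e L h x"
proof -
  have "(d * (c * A) - \<beta> * (c * B)) / D * P - c * R = c * ((d * A - \<beta> * B) / D * P - R)" for A B D P R :: real
    by (simp add: diff_divide_distrib algebra_simps)
  then show ?thesis by (simp only: green_solution_def rl_cmult)
qed

text \<open>Since the solution operator is linear and positive, \<open>\<bar>h\<bar> \<le> M\<close> forces the solution for \<open>h\<close> to lie between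
  the solutions for \<open>- M\<close> and \<open>M\<close>. For the latter the two negative contributions may be dropped.
  Estimating the three terms separately instead would give a constant too large for the
  contraction argument.\<close>

lemma green_abs_le:
  assumes \<beta>: "\<beta> \<ge> 0" and mu: "\<mu> > 0" and x: "x \<in> {0..L}"
    and h: "continuous_on {0..L} h" and M: "\<And>s. s \<in> {0..L} \<Longrightarrow> \<bar>h s\<bar> \<le> M"
  shows "\<bar>green_solution \<alpha> \<beta> d e L h x\<bar> \<le> M * (d * L powr (\<alpha> - 1) * L powr (\<alpha> - 1) / (\<mu> * Gamma \<alpha>))"
proof -
  \<comment> \<open>The signs \<open>c = 1\<close> and \<open>c = - 1\<close> give the two halves of the estimate.\<close>
  have "0 \<le> green_solution \<alpha> \<beta> d e L (\<lambda>s. M * 1 + c * h s) x" if "c = 1 \<or> c = - 1" for c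
    using that M by (intro green_nonneg \<beta> mu x continuous_intros h) (force simp: abs_le_iff)
  moreover have "green_solution \<alpha> \<beta> d e L (\<lambda>s. M * 1 + c * h s) x = M * green_solution \<alpha> \<beta> d e L (\<lambda>_. 1) x + c * green_solution \<alpha> \<beta> d e L h x" for c
    by (subst green_add[OF x]) (intro continuous_intros h, intro continuous_intros h, simp only: green_cmult)
  ultimately have "0 \<le> M * green_solution \<alpha> \<beta> d e L (\<lambda>_. 1) x + c * green_solution \<alpha> \<beta> d e L h x" if "c = 1 \<or> c = - 1" for c
    using that by metis
  from this[of 1] this[of "- 1"]
  have "\<bar>green_solution \<alpha> \<beta> d e L h x\<bar> \<le> M * green_solution \<alpha> \<beta> d e L (\<lambda>_. 1) x" by auto
  also have "\<dots> \<le> M * (d * L powr (\<alpha> - 1) * L powr (\<alpha> - 1) / (\<mu> * Gamma \<alpha>))"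
  proof (rule mult_left_mono)
    show "0 \<le> M" using M[of 0] L by force
    have "Gamma (\<alpha> + 1) > 0" "Gamma \<alpha> > 0" using \<alpha> by (auto intro!: Gamma_real_pos)
    then have r: "0 \<le> rl_integral \<alpha> (\<lambda>_. 1) e" "0 \<le> rl_integral \<alpha> (\<lambda>_. 1) x"
      using \<alpha> e x by (auto simp: rl_const)
    have rL: "rl_integral (\<alpha> - 1) (\<lambda>_. 1) L = L powr (\<alpha> - 1) / Gamma \<alpha>"
      using rl_const[of "\<alpha> - 1" L] \<alpha> L by simp
    have "green_solution \<alpha> \<beta> d e L (\<lambda>_. 1) x \<le> (d * rl_integral (\<alpha> - 1) (\<lambda>_. 1) L - \<beta> * rl_integral \<alpha> (\<lambda>_. 1) e) / \<mu> * x powr (\<alpha> - 1)"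
      using r by (simp add: green_solution_def \<mu>)
    also have "\<dots> \<le> (d * rl_integral (\<alpha> - 1) (\<lambda>_. 1) L) / \<mu> * x powr (\<alpha> - 1)"
      using r mu \<beta> by (intro mult_right_mono divide_right_mono) auto
    also have "\<dots> \<le> (d * rl_integral (\<alpha> - 1) (\<lambda>_. 1) L) / \<mu> * L powr (\<alpha> - 1)"
      using x mu d \<alpha> \<open>Gamma \<alpha> > 0\<close> unfolding rL
      by (intro mult_left_mono powr_mono2) auto
    finally show "green_solution \<alpha> \<beta> d e L (\<lambda>_. 1) x \<le> d * L powr (\<alpha> - 1) * L powr (\<alpha> - 1) / (\<mu> * Gamma \<alpha>)"
      unfolding rL by (simp add: mult_ac)
  qed
  finally show ?thesis .
qed

lemma continuous_on_green:
  assumes h: "continuous_on {0..L} h"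
  shows "continuous_on {0..L} (green_solution \<alpha> \<beta> d e L h)"
proof -
  have pw: "continuous_on {0..L} (\<lambda>x. x powr (\<alpha> - 1))"
    using \<alpha> by (intro continuous_on_powr' continuous_intros) auto
  have rc: "continuous_on {0..L} (rl_integral \<alpha> h)" using \<alpha> h by (intro continuous_on_rl) auto
  have "continuous_on {0..L} (\<lambda>x. c * x powr (\<alpha> - 1) - rl_integral \<alpha> h x)" for c
    by (intro continuous_intros pw rc)
  then show ?thesis unfolding green_solution_def[abs_def] by blast
qed

end

section \<open>The fixed point argument\<close>

text \<open>Banach's theorem, applied in the complete space of bounded continuous functions on the line. A
  function on \<open>[0, L]\<close> is moved there by composing it with the retraction of the line onto \<open>[0, L]\<close>. The
  contraction condition also forces \<open>T u\<close> to depend on the values of \<open>u\<close> in \<open>[0, L]\<close> only.\<close>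

lemma contraction_on_Icc_fixpoint:
  fixes T :: "(real \<Rightarrow> real) \<Rightarrow> real \<Rightarrow> real"
  assumes L: "0 \<le> L" and c: "0 \<le> c" "c < 1"
    and cont: "\<And>u. continuous_on {0..L} u \<Longrightarrow> continuous_on {0..L} (T u)"
    and contr: "\<And>u v M x. continuous_on {0..L} u \<Longrightarrow> continuous_on {0..L} v \<Longrightarrow>
       (\<And>s. s \<in> {0..L} \<Longrightarrow> \<bar>u s - v s\<bar> \<le> M) \<Longrightarrow> x \<in> {0..L} \<Longrightarrow> \<bar>T u x - T v x\<bar> \<le> c * M"
  shows "\<exists>u. continuous_on {0..L} u \<and> (\<forall>x\<in>{0..L}. T u x = u x) \<and>
     (\<forall>v. continuous_on {0..L} v \<longrightarrow> (\<forall>x\<in>{0..L}. T v x = v x) \<longrightarrow> (\<forall>x\<in>{0..L}. v x = u x))"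
proof -
  define r where "r = (\<lambda>x::real. max 0 (min L x))"
  have r: "r x \<in> {0..L}" for x using L by (auto simp: r_def)
  have rid: "r x = x" if "x \<in> {0..L}" for x using that by (auto simp: r_def)
  have rc: "continuous_on UNIV r" unfolding r_def by (intro continuous_intros)
  define S where "S = (\<lambda>w. Bcontfun (\<lambda>x. T (apply_bcontfun w) (r x)))"
  have cw: "continuous_on {0..L} (apply_bcontfun w)" for w :: "real \<Rightarrow>\<^sub>C real"
    using apply_bcontfun[of w] by (auto simp: bcontfun_def intro: continuous_on_subset)
  have S: "apply_bcontfun (S w) = (\<lambda>x. T (apply_bcontfun w) (r x))" for w
  proof -
    obtain B where B: "\<And>x. x \<in> {0..L} \<Longrightarrow> \<bar>T (apply_bcontfun w) x\<bar> \<le> B"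
      using compact_imp_bounded[OF compact_continuous_image[OF cont[OF cw[of w]]]]
      by (force simp: bounded_iff)
    have "(\<lambda>x. T (apply_bcontfun w) (r x)) \<in> bcontfun"
      using B r by (intro bcontfun_normI[of _ B] continuous_on_compose2[OF cont[OF cw] rc]) auto
    then show ?thesis unfolding S_def by (rule Bcontfun_inverse)
  qed
  have "\<exists>!w. S w = w"
  proof (rule banach_fix_type[OF c], intro allI dist_bound)
    fix v w :: "real \<Rightarrow>\<^sub>C real" and x
    show "dist (apply_bcontfun (S v) x) (apply_bcontfun (S w) x) \<le> c * dist v w"
      unfolding S dist_real_def
      by (rule contr[OF cw cw _ r]) (metis dist_bounded dist_real_def)
  qed
  then obtain w where w: "S w = w" by blast
  define u where "u = apply_bcontfun w"
  have uc: "continuous_on {0..L} u" unfolding u_def by (rule cw)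
  have uT: "T u x = u x" if "x \<in> {0..L}" for x
    using S[of w] rid[OF that] unfolding w u_def by metis
  have "v x = u x" if v: "continuous_on {0..L} v" "\<forall>x\<in>{0..L}. T v x = v x" and x: "x \<in> {0..L}" for v x
  proof -
    have "continuous_on {0..L} (\<lambda>s. \<bar>v s - u s\<bar>)" by (intro continuous_intros v(1) uc)
    then obtain z where z: "z \<in> {0..L}" "\<And>s. s \<in> {0..L} \<Longrightarrow> \<bar>v s - u s\<bar> \<le> \<bar>v z - u z\<bar>"
      using continuous_attains_sup[of "{0..L}" "\<lambda>s. \<bar>v s - u s\<bar>"] L by auto
    have "\<bar>v z - u z\<bar> \<le> c * \<bar>v z - u z\<bar>"
      using contr[OF v(1) uc z(2) z(1)] v(2) uT z(1) by simp
    then have "(1 - c) * \<bar>v z - u z\<bar> \<le> 0" by (simp add: algebra_simps)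
    then have "\<bar>v z - u z\<bar> = 0" using c by (simp add: mult_le_0_iff)
    then show ?thesis using z(2)[OF x] by simp
  qed
  then show ?thesis using uc uT by blast
qed

lemma green_nonlinear_fixpoint:
  fixes \<alpha> \<beta> d e L \<mu> q :: real and n :: nat and f :: "real \<Rightarrow> real \<Rightarrow> real"
  assumes \<alpha>: "2 < \<alpha>" "\<alpha> \<le> 3" and n: "real n - 1 \<le> \<alpha>" "\<alpha> < real n"
    and L: "0 < L" and e: "0 < e" "e \<le> L" and d: "d > 0"
    and \<mu>: "\<mu> = (\<alpha> - 1) * d * L powr (\<alpha> - 2) - \<beta> * e powr (\<alpha> - 1)"
    and \<beta>: "\<beta> \<ge> 0" and mu: "\<mu> > 0"
    and f: "continuous_on ({0..L} \<times> UNIV) (\<lambda>(x, a). f x a)"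
    and lip: "\<And>x a b. x \<in> {0..L} \<Longrightarrow> \<bar>f x a - f x b\<bar> \<le> q * \<bar>a - b\<bar>" and q: "q \<ge> 0"
    and small: "q * (d * L powr (\<alpha> - 1) * L powr (\<alpha> - 1) / (\<mu> * Gamma \<alpha>)) < 1"
  defines "T \<equiv> \<lambda>v. green_solution \<alpha> \<beta> d e L (\<lambda>s. f s (v s))"
  shows "\<exists>u. continuous_on {0..L} u \<and> (\<forall>x\<in>{0..L}. T u x = u x) \<and>
     (\<forall>v. continuous_on {0..L} v \<longrightarrow> (\<forall>x\<in>{0..L}. T v x = v x) \<longrightarrow> (\<forall>x\<in>{0..L}. v x = u x))"
proof (rule contraction_on_Icc_fixpoint)
  note params = \<alpha> n L e d \<mu>
  define C where "C = d * L powr (\<alpha> - 1) * L powr (\<alpha> - 1) / (\<mu> * Gamma \<alpha>)"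
  have "Gamma \<alpha> > 0" using \<alpha> by (intro Gamma_real_pos) simp
  then have "C \<ge> 0" using mu d by (simp add: C_def)
  then show "0 \<le> q * (d * L powr (\<alpha> - 1) * L powr (\<alpha> - 1) / (\<mu> * Gamma \<alpha>))"
    using q by (simp flip: C_def)
  show "0 \<le> L" using L by simp
  have fc: "continuous_on {0..L} (\<lambda>s. f s (v s))" if v: "continuous_on {0..L} v" for v
  proof -
    have "continuous_on {0..L} (\<lambda>s. (s, v s))" by (intro continuous_intros v)
    from continuous_on_compose2[OF f this] show ?thesis by auto
  qed
  show "continuous_on {0..L} (T u)" if "continuous_on {0..L} u" for u
    unfolding T_def by (rule continuous_on_green[OF params fc[OF that]])
  fix u v :: "real \<Rightarrow> real" and M x
  assume u: "continuous_on {0..L} u" and v: "continuous_on {0..L} v"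
    and M: "\<And>s. s \<in> {0..L} \<Longrightarrow> \<bar>u s - v s\<bar> \<le> M" and x: "x \<in> {0..L}"
  define h where "h = (\<lambda>s. f s (u s) + - 1 * f s (v s))"
  have "continuous_on {0..L} (\<lambda>s. - 1 * f s (v s))" by (intro continuous_intros fc v)
  from green_add[OF params x fc[OF u] this]
  have "T u x - T v x = green_solution \<alpha> \<beta> d e L h x"
    unfolding T_def h_def green_cmult[OF params] by simp
  moreover have "\<bar>green_solution \<alpha> \<beta> d e L h x\<bar> \<le> (q * M) * (d * L powr (\<alpha> - 1) * L powr (\<alpha> - 1) / (\<mu> * Gamma \<alpha>))"
  proof (rule green_abs_le[OF params \<beta> mu x])
    show "continuous_on {0..L} h" unfolding h_def by (intro continuous_intros fc u v)
    fix s assume s: "s \<in> {0..L}"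
    have "\<bar>h s\<bar> \<le> q * \<bar>u s - v s\<bar>" using lip[OF s] by (simp add: h_def)
    also have "\<dots> \<le> q * M" using M[OF s] q by (rule mult_left_mono)
    finally show "\<bar>h s\<bar> \<le> q * M" .
  qed
  ultimately show "\<bar>T u x - T v x\<bar> \<le> q * (d * L powr (\<alpha> - 1) * L powr (\<alpha> - 1) / (\<mu> * Gamma \<alpha>)) * M"
    by (simp add: mult_ac)
qed (use small in auto)

lemma green_cong:
  assumes "\<And>s. s \<in> {0..L} \<Longrightarrow> h s = k s" "e \<in> {0..L}" "x \<in> {0..L}"
  shows "green_solution \<alpha> \<beta> d e L h x = green_solution \<alpha> \<beta> d e L k x"
proof -
  have "rl_integral a h y = rl_integral a k y" if "y \<in> {0..L}" for a y
    using that by (intro rl_cong assms(1)) auto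
  then show ?thesis using assms(2,3) by (simp add: green_solution_def)
qed

section \<open>The substitution\<close>

text \<open>The inverse function rule for one-sided derivatives: the difference quotients of \<open>q\<close> are the
  reciprocals of those of \<open>f\<close>, taken at points \<open>q z\<close> tending to \<open>q x\<close>.\<close>

lemma has_field_derivative_inverse_within:
  fixes f q :: "real \<Rightarrow> real"
  assumes f: "(f has_field_derivative D) (at (q x) within S)" and D: "D \<noteq> 0"
    and x: "x \<in> T" and inv: "\<And>z. z \<in> T \<Longrightarrow> q z \<in> S \<and> f (q z) = z" and q: "continuous_on T q"
  shows "(q has_field_derivative inverse D) (at x within T)"
proof -
  have "filterlim q (at (q x) within S) (at x within T)"
  proof (rule filterlim_at[THEN iffD2], intro conjI)
    show "(q \<longlongrightarrow> q x) (at x within T)" using q x by (simp add: continuous_on_def)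
    have "q z \<in> S \<and> q z \<noteq> q x" if "z \<in> T" "z \<noteq> x" for z
      using inv[OF that(1)] inv[OF x] that(2) by metis
    then show "\<forall>\<^sub>F z in at x within T. q z \<in> S \<and> q z \<noteq> q x"
      by (auto simp: eventually_at_filter)
  qed
  then have "((\<lambda>z. (f (q z) - f (q x)) / (q z - q x)) \<longlongrightarrow> D) (at x within T)"
    using f unfolding has_field_derivative_iff by (rule filterlim_compose[rotated])
  then have "((\<lambda>z. inverse ((f (q z) - f (q x)) / (q z - q x))) \<longlongrightarrow> inverse D) (at x within T)"
    using D by (rule tendsto_inverse)
  moreover have "\<forall>\<^sub>F z in at x within T. inverse ((f (q z) - f (q x)) / (q z - q x)) = (q z - q x) / (z - x)"
    using inv x by (auto simp: eventually_at_filter inverse_eq_divide)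
  ultimately show ?thesis
    unfolding has_field_derivative_iff by (rule Lim_transform_eventually)
qed

lemma deriv01_eq:
  assumes "(f has_real_derivative D) (at t within {0..1})" "t \<in> {0..1}"
  shows "deriv01 f t = D"
  using vector_derivative_within_cbox[of 0 1 t f D] assms
  by (simp add: deriv01_def has_real_derivative_iff_has_vector_derivative)

lemma has_deriv01_if_differentiable:
  assumes "f differentiable (at t within {0..1})"
  shows "(f has_real_derivative deriv01 f t) (at t within {0..1})"
  using assms unfolding deriv01_def
  by (simp add: vector_derivative_works has_real_derivative_iff_has_vector_derivative)

text \<open>What the substitution \<open>x = \<Phi>(t)\<close> needs: differentiability of \<open>\<phi>\<close> up to the end points with nonvanishing
  derivative.\<close>

locale phi_substitution =
  fixes \<phi> :: "real \<Rightarrow> real"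
  assumes strict_mono: "strict_mono_on {0..1} \<phi>"
    and deriv: "\<And>t. t \<in> {0..1} \<Longrightarrow> (\<phi> has_real_derivative deriv01 \<phi> t) (at t within {0..1})"
    and deriv_nz: "\<And>t. t \<in> {0..1} \<Longrightarrow> deriv01 \<phi> t \<noteq> 0"
begin

abbreviation P :: "real \<Rightarrow> real" where "P \<equiv> Phi \<phi>"
abbreviation L :: real where "L \<equiv> Phi \<phi> 1"
definition Q :: "real \<Rightarrow> real" where "Q = inv_into {0..1} P"

lemma P_less: "s \<in> {0..1} \<Longrightarrow> t \<in> {0..1} \<Longrightarrow> s < t \<Longrightarrow> P s < P t"
  using strict_mono by (auto simp: Phi_def strict_mono_on_def)

lemma P_less_iff: "s \<in> {0..1} \<Longrightarrow> t \<in> {0..1} \<Longrightarrow> P s < P t \<longleftrightarrow> s < t"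
  using P_less[of s t] P_less[of t s] by (cases s t rule: linorder_cases) auto

lemma P_le_iff: "s \<in> {0..1} \<Longrightarrow> t \<in> {0..1} \<Longrightarrow> P s \<le> P t \<longleftrightarrow> s \<le> t"
  using P_less_iff[of t s] by (simp add: not_less[symmetric])

lemma P_0: "P 0 = 0"
  by (simp add: Phi_def)

lemma L_pos: "0 < L"
  using P_less[of 0 1] P_0 by simp

lemma P_inj: "inj_on P {0..1}"
  using P_less by (auto simp: inj_on_def) (metis atLeastAtMost_iff less_irrefl linorder_neqE_linordered_idom)

lemma P_has_real_derivative:
  "t \<in> {0..1} \<Longrightarrow> (P has_real_derivative deriv01 \<phi> t) (at t within {0..1})"
  unfolding Phi_def[abs_def] by (auto intro!: derivative_eq_intros deriv)

lemma P_continuous: "continuous_on {0..1} P"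
  by (rule DERIV_continuous_on[OF P_has_real_derivative])

lemma P_image: "P ` {0..1} = {0..L}"
proof
  show "P ` {0..1} \<subseteq> {0..L}" using P_le_iff[of 0] P_le_iff[of _ 1] P_0 by auto
  show "{0..L} \<subseteq> P ` {0..1}"
    using IVT'[OF _ _ _ P_continuous] P_0 by force
qed

lemma P_Q: "x \<in> {0..L} \<Longrightarrow> P (Q x) = x"
  unfolding Q_def by (rule f_inv_into_f) (simp add: P_image)

lemma Q_in: "x \<in> {0..L} \<Longrightarrow> Q x \<in> {0..1}"
  unfolding Q_def by (rule inv_into_into) (simp add: P_image)

lemma Q_P: "t \<in> {0..1} \<Longrightarrow> Q (P t) = t"
  unfolding Q_def by (rule inv_into_f_f[OF P_inj])

lemma P_in: "t \<in> {0..1} \<Longrightarrow> P t \<in> {0..L}"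
  using P_image by blast

lemma P_in_open: "t \<in> {0<..<1} \<Longrightarrow> P t \<in> {0<..<L}"
  using P_less[of 0 t] P_less[of t 1] P_0 by auto

lemma Q_in_open: "x \<in> {0<..<L} \<Longrightarrow> Q x \<in> {0<..<1}"
  using Q_in[of x] P_Q[of x] P_0 by (cases "Q x = 0 \<or> Q x = 1") (auto simp: less_le)

lemma Q_continuous: "continuous_on {0..L} Q"
  using continuous_on_inv[OF P_continuous, of Q] Q_P by (simp add: P_image)

lemma P_image_initial: "t \<in> {0..1} \<Longrightarrow> P ` {0..t} = {0..P t}"
proof
  assume t: "t \<in> {0..1}"
  show "P ` {0..t} \<subseteq> {0..P t}" using t P_le_iff[of 0] P_le_iff[of _ t] P_0 by auto
  show "{0..P t} \<subseteq> P ` {0..t}"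
  proof
    fix x assume x: "x \<in> {0..P t}"
    then have xL: "x \<in> {0..L}" using P_in[OF t] by auto
    then have "Q x \<le> t" using P_le_iff[OF Q_in t] P_Q x by auto
    then have "Q x \<in> {0..t}" using Q_in[OF xL] by auto
    then show "x \<in> P ` {0..t}" using P_Q[OF xL] by (metis imageI)
  qed
qed

lemma deriv_pos: "t \<in> {0..1} \<Longrightarrow> deriv01 \<phi> t > 0"
proof -
  assume t: "t \<in> {0..1}"
  have "at t within {0..1::real} \<noteq> bot"
    using t at_within_Icc_at_right[of 0 "1::real"] at_within_Icc_at_left[of 0 "1::real"] at_within_Icc_at[of 0 t 1]
      trivial_limit_at_right_real[of "0::real"] trivial_limit_at_left_real[of "1::real"]
    by (cases "t = 0"; cases "t = 1") auto
  moreover have "((\<lambda>s. (\<phi> s - \<phi> t) / (s - t)) \<longlongrightarrow> deriv01 \<phi> t) (at t within {0..1})"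
    using deriv[OF t] by (simp add: has_field_derivative_iff)
  moreover have "\<forall>\<^sub>F s in at t within {0..1}. 0 \<le> (\<phi> s - \<phi> t) / (s - t)"
  proof -
    have "0 \<le> (\<phi> s - \<phi> t) / (s - t)" if "s \<in> {0..1}" for s
      using P_le_iff[OF that t] P_le_iff[OF t that]
      by (cases "s \<le> t") (auto simp: Phi_def zero_le_divide_iff)
    then show ?thesis by (auto simp: eventually_at_filter)
  qed
  ultimately have "0 \<le> deriv01 \<phi> t"
    by (metis tendsto_lowerbound)
  then show ?thesis using deriv_nz[OF t] by simp
qed

lemma Q_has_real_derivative:
  "t \<in> {0..1} \<Longrightarrow> (Q has_real_derivative 1 / deriv01 \<phi> t) (at (P t) within {0..L})"
  using has_field_derivative_inverse_within[of P "deriv01 \<phi> t" Q "P t" "{0..1}" "{0..L}"]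
    P_has_real_derivative[of t] deriv_nz[of t] Q_P[of t] P_in[of t] Q_in P_Q Q_continuous
  by (auto simp: inverse_eq_divide)

lemma has_derivative_comp_P:
  assumes "(v has_real_derivative D) (at (P t) within {0..L})" "t \<in> {0..1}"
  shows "((\<lambda>s. v (P s)) has_real_derivative D * deriv01 \<phi> t) (at t within {0..1})"
  using DERIV_image_chain[of v D P t "{0..1}"] assms P_has_real_derivative P_image by (simp add: o_def)

lemma has_derivative_comp_Q:
  assumes u: "(u has_real_derivative D) (at t within {0..1})" and t: "t \<in> {0..1}"
  shows "((\<lambda>x. u (Q x)) has_real_derivative D / deriv01 \<phi> t) (at (P t) within {0..L})"
proof -
  have "Q ` {0..L} \<subseteq> {0..1}" using Q_in by auto
  with u have "(u has_real_derivative D) (at (Q (P t)) within Q ` {0..L})"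
    using Q_P[OF t] by (auto intro: has_field_derivative_subset)
  from DERIV_image_chain[OF this Q_has_real_derivative[OF t]] show ?thesis by (simp add: o_def)
qed

text \<open>The substitution rule for absolutely integrable functions copes with the singularity of the kernel at
  the upper limit.\<close>

lemma phi_RL_integral_eq_rl:
  assumes g: "\<gamma> > 0" and u: "continuous_on {0..1} u" and t: "t \<in> {0..1}"
  shows "phi_RL_integral \<gamma> \<phi> u t = rl_integral \<gamma> (\<lambda>x. u (Q x)) (P t)"
proof -
  let ?f = "\<lambda>y. (P t - y) powr (\<gamma> - 1) * u (Q y)"
  have sub: "{0..t} \<subseteq> {0..1}" using t by auto
  have Pt: "{0..P t} \<subseteq> {0..L}" using P_in[OF t] by auto
  have "continuous_on {0..P t} (\<lambda>x. u (Q x))"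
    by (rule continuous_on_compose2[OF u continuous_on_subset[OF Q_continuous Pt]]) (use Q_in Pt in auto)
  then have "?f absolutely_integrable_on P ` {0..t}"
    using rl_integrand_absolutely_integrable[OF g] P_image_initial[OF t] by simp
  moreover have "(P has_real_derivative deriv01 \<phi> s) (at s within {0..t})" if "s \<in> {0..t}" for s
    using P_has_real_derivative[of s] that sub by (auto intro: has_field_derivative_subset)
  ultimately have "integral {0..t} (\<lambda>s. \<bar>deriv01 \<phi> s\<bar> * ?f (P s)) = integral (P ` {0..t}) ?f"
    using has_absolute_integral_change_of_variables_1'[of "{0..t}" P "deriv01 \<phi>" ?f "integral (P ` {0..t}) ?f"]
      inj_on_subset[OF P_inj sub] by auto
  moreover have "integral {0..t} (\<lambda>s. \<bar>deriv01 \<phi> s\<bar> * ?f (P s))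
      = integral {0..t} (\<lambda>s. deriv01 \<phi> s * (\<phi> t - \<phi> s) powr (\<gamma> - 1) * u s)"
  proof (rule integral_cong)
    fix s assume "s \<in> {0..t}"
    then have s: "s \<in> {0..1}" using sub by blast
    show "\<bar>deriv01 \<phi> s\<bar> * ?f (P s) = deriv01 \<phi> s * (\<phi> t - \<phi> s) powr (\<gamma> - 1) * u s"
      using abs_of_pos[OF deriv_pos[OF s]] Q_P[OF s] by (simp add: Phi_def)
  qed
  ultimately show ?thesis
    unfolding phi_RL_integral_def rl_integral_def P_image_initial[OF t] by simp
qed

text \<open>The chain rule: dividing by \<open>\<phi>'\<close> makes the operator the ordinary derivative in the variable
  \<open>x = \<Phi>(t)\<close>.\<close>

lemma phi_diff_op_comp_P:
  assumes t: "t \<in> {0<..<1}" and W: "(W has_real_derivative D) (at (P t))"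
    and G: "\<And>s. s \<in> {0<..<1} \<Longrightarrow> G s = W (P s)"
  shows "(G has_real_derivative D * deriv01 \<phi> t) (at t within {0..1})" "phi_diff_op \<phi> G t = D"
proof -
  have t': "t \<in> {0..1}" using t by auto
  have "((\<lambda>s. W (P s)) has_real_derivative D * deriv01 \<phi> t) (at t)"
    using has_derivative_comp_P[OF has_field_derivative_at_within[OF W] t'] t by (simp add: at_within_Icc_at)
  then have "(G has_real_derivative D * deriv01 \<phi> t) (at t)"
    by (rule has_field_derivative_transform_within_open[of _ _ _ "{0<..<1}"]) (use t G in auto)
  then show *: "(G has_real_derivative D * deriv01 \<phi> t) (at t within {0..1})"
    by (rule has_field_derivative_at_within)
  show "phi_diff_op \<phi> G t = D"
    using deriv01_eq[OF * t'] deriv_nz[OF t'] by (simp add: phi_diff_op_def)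
qed

text \<open>The integral, the differential operator and the one-sided derivatives in the boundary conditions each
  turn into their classical counterparts for \<open>u \<circ> Q\<close>, so the problem on \<open>[0, 1]\<close> is equivalent to the
  classical one on \<open>[0, L]\<close>.\<close>

lemma bvp_solution_iff_rl_bvp:
  assumes u: "continuous_on {0..1} u" and \<alpha>: "\<alpha> < real (frac_order \<alpha>)" and \<eta>: "\<eta> \<in> {0..1}"
  shows "bvp_solution \<alpha> \<beta> \<eta> \<phi> f u \<longleftrightarrow>
    rl_bvp \<alpha> (frac_order \<alpha>) \<beta> (deriv01 \<phi> 1) (P \<eta>) L (\<lambda>x. f (Q x) (u (Q x))) (\<lambda>x. u (Q x))"
proof -
  define n where "n = frac_order \<alpha>"
  define I where "I = phi_RL_integral (real n - \<alpha>) \<phi> u"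
  have I: "I t = rl_integral (real n - \<alpha>) (\<lambda>x. u (Q x)) (P t)" if "t \<in> {0..1}" for t
    unfolding I_def using \<alpha> that by (intro phi_RL_integral_eq_rl u) (auto simp: n_def)
  have one: "(1::real) \<in> {0..1}" and zero: "(0::real) \<in> {0..1}" by auto
  have uQ: "continuous_on {0..L} (\<lambda>x. u (Q x))"
    by (rule continuous_on_compose2[OF u Q_continuous]) (use Q_in in auto)
  have bc: "(u has_real_derivative D) (at t within {0..1}) \<longleftrightarrow>
      ((\<lambda>x. u (Q x)) has_real_derivative D / deriv01 \<phi> t) (at (P t) within {0..L})"
    if t: "t \<in> {0..1}" for D t
  proof
    assume "((\<lambda>x. u (Q x)) has_real_derivative D / deriv01 \<phi> t) (at (P t) within {0..L})"
    from has_derivative_comp_P[OF this t]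
    have "((\<lambda>s. u (Q (P s))) has_real_derivative D) (at t within {0..1})"
      using deriv_nz[OF t] by simp
    then show "(u has_real_derivative D) (at t within {0..1})"
      by (rule has_field_derivative_transform_within[OF _ zero_less_one t]) (simp add: Q_P)
  qed (rule has_derivative_comp_Q[OF _ t])
  have eqn: "phi_RL_differentiable \<alpha> \<phi> u \<and> (\<forall>t\<in>{0<..<1}. phi_RL_deriv \<alpha> \<phi> u t + f t (u t) = 0) \<longleftrightarrow>
     (\<exists>W. \<forall>x\<in>{0<..<L}. W 0 x = rl_integral (real n - \<alpha>) (\<lambda>x. u (Q x)) x \<and> W n x = - f (Q x) (u (Q x)) \<and>
        (\<forall>k<n. (W k has_real_derivative W (Suc k) x) (at x)))" (is "?A \<longleftrightarrow> ?B")
  proof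
    assume A: ?A
    define W where "W = (\<lambda>k x. (phi_diff_op \<phi> ^^ k) I (Q x))"
    have "W 0 x = rl_integral (real n - \<alpha>) (\<lambda>x. u (Q x)) x \<and> W n x = - f (Q x) (u (Q x)) \<and>
        (\<forall>k<n. (W k has_real_derivative W (Suc k) x) (at x))" if x: "x \<in> {0<..<L}" for x
    proof (intro conjI allI impI)
      have x': "x \<in> {0..L}" using x by auto
      have Qx: "Q x \<in> {0<..<1}" by (rule Q_in_open[OF x])
      show "W 0 x = rl_integral (real n - \<alpha>) (\<lambda>x. u (Q x)) x"
        using I[OF Q_in[OF x']] P_Q[OF x'] by (simp add: W_def)
      have "phi_RL_deriv \<alpha> \<phi> u (Q x) + f (Q x) (u (Q x)) = 0" using A Qx by blast
      then show "W n x = - f (Q x) (u (Q x))"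
        by (simp add: W_def phi_RL_deriv_def I_def n_def)
      fix k assume k: "k < n"
      have "(phi_diff_op \<phi> ^^ k) I differentiable (at (Q x) within {0..1})"
        using A k Qx unfolding phi_RL_differentiable_def I_def n_def by blast
      from has_derivative_comp_Q[OF has_deriv01_if_differentiable[OF this] Q_in[OF x']]
      have "(W k has_real_derivative W (Suc k) x) (at x within {0..L})"
        using P_Q[OF x'] by (simp add: W_def phi_diff_op_def)
      then show "(W k has_real_derivative W (Suc k) x) (at x)"
        using x by (simp add: at_within_Icc_at)
    qed
    then show ?B by (intro exI[of _ W] ballI)
  next
    assume ?B
    then obtain W where W0: "\<And>x. x \<in> {0<..<L} \<Longrightarrow> W 0 x = rl_integral (real n - \<alpha>) (\<lambda>x. u (Q x)) x"
      and Wn: "\<And>x. x \<in> {0<..<L} \<Longrightarrow> W n x = - f (Q x) (u (Q x))"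
      and WS: "\<And>x k. x \<in> {0<..<L} \<Longrightarrow> k < n \<Longrightarrow> (W k has_real_derivative W (Suc k) x) (at x)"
      by blast
    have iter: "(phi_diff_op \<phi> ^^ k) I t = W k (P t)" if "k \<le> n" "t \<in> {0<..<1}" for k t
      using that
    proof (induction k arbitrary: t)
      case 0
      then show ?case using I[of t] W0[OF P_in_open[of t]] by simp
    next
      case (Suc k)
      have "(W k has_real_derivative W (Suc k) (P t)) (at (P t))"
        using Suc.prems by (intro WS P_in_open) auto
      from phi_diff_op_comp_P(2)[OF Suc.prems(2) this, of "(phi_diff_op \<phi> ^^ k) I"] Suc
      show ?case by simp
    qed
    have "(phi_diff_op \<phi> ^^ k) I differentiable (at t within {0..1})" if k: "k < n" and t: "t \<in> {0<..<1}" for k t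
    proof -
      have "((phi_diff_op \<phi> ^^ k) I has_real_derivative W (Suc k) (P t) * deriv01 \<phi> t) (at t within {0..1})"
        by (rule phi_diff_op_comp_P(1)[OF t WS[OF P_in_open[OF t] k]]) (use iter k in auto)
      then show ?thesis by (auto simp: real_differentiable_def)
    qed
    moreover have "phi_RL_deriv \<alpha> \<phi> u t + f t (u t) = 0" if t: "t \<in> {0<..<1}" for t
    proof -
      have "(phi_diff_op \<phi> ^^ n) I t = - f (Q (P t)) (u (Q (P t)))"
        using iter[OF order_refl t] Wn[OF P_in_open[OF t]] by simp
      moreover have "Q (P t) = t" using t by (intro Q_P) auto
      ultimately show ?thesis by (simp add: phi_RL_deriv_def I_def n_def)
    qed
    ultimately show ?A by (simp add: phi_RL_differentiable_def I_def n_def)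
  qed
  have Q0: "Q 0 = 0" using Q_P[OF zero] P_0 by simp
  show ?thesis
    unfolding bvp_solution_def rl_bvp_def n_def[symmetric]
    using u uQ eqn bc[OF zero, of 0] bc[OF one, of "\<beta> * u \<eta>"] Q0 Q_P[OF \<eta>] P_0 by auto
qed

end

section \<open>Existence and uniqueness\<close>

lemma frac_order_bounds:
  assumes "0 \<le> \<alpha>"
  shows "real (frac_order \<alpha>) - 1 \<le> \<alpha>" "\<alpha> < real (frac_order \<alpha>)"
proof -
  have "real (nat \<lfloor>\<alpha>\<rfloor>) = of_int \<lfloor>\<alpha>\<rfloor>" using assms by simp
  then show "real (frac_order \<alpha>) - 1 \<le> \<alpha>" "\<alpha> < real (frac_order \<alpha>)"
    unfolding frac_order_def by linarith+
qed

lemma abs_le_sup_norm01: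
  assumes "continuous_on {0..1} g" "t \<in> {0..1}"
  shows "\<bar>g t\<bar> \<le> sup_norm01 g"
proof -
  have "bdd_above ((\<lambda>t. \<bar>g t\<bar>) ` {0..1})"
    using assms(1) by (intro bounded_imp_bdd_above compact_imp_bounded compact_continuous_image continuous_intros) auto
  then show ?thesis unfolding sup_norm01_def by (rule cSUP_upper[OF assms(2)])
qed

theorem theorem3p1:
  fixes \<alpha> \<beta> \<eta> :: real
    and \<phi> g :: "real \<Rightarrow> real"
    and f :: "real \<Rightarrow> real \<Rightarrow> real"
  assumes "2 < \<alpha>" and "\<alpha> \<le> 3" and "\<beta> \<ge> 0" and "0 < \<eta>" and "\<eta> \<le> 1"
    and "\<phi> ` {0..1} \<subseteq> {0..1}"
    and "strict_mono_on {0..1} \<phi>"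
    and "C_class01 (frac_order \<alpha>) \<phi>"
    and "\<forall>x\<in>{0..1}. deriv01 \<phi> x \<noteq> 0"
    and "continuous_on ({0..1} \<times> UNIV) (\<lambda>(t, x). f t x)"
    and "continuous_on {0..1} g"
    and "\<forall>t\<in>{0..1}. g t \<ge> 0"
    and "\<exists>t\<in>{0..1}. g t \<noteq> 0"
    and "\<forall>t\<in>{0..1}. \<forall>u v. \<bar>f t u - f t v\<bar> \<le> g t * \<bar>u - v\<bar>"
    and "sup_norm01 g < mu_const \<alpha> \<beta> \<eta> \<phi> * Gamma \<alpha>
           / (sqrt 2 * Phi \<phi> 1 powr (\<alpha> - 1) * deriv01 \<phi> 1)"
  shows "\<exists>u. bvp_solution \<alpha> \<beta> \<eta> \<phi> f u \<and>
           (\<forall>v. bvp_solution \<alpha> \<beta> \<eta> \<phi> f v \<longrightarrow> (\<forall>t\<in>{0..1}. v t = u t))"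
proof -
  interpret phi_substitution \<phi>
  proof
    have "\<phi> differentiable_on {0..1}"
      using assms(8) unfolding C_class01_def frac_order_def
      by (metis funpow_0 zero_less_Suc Suc_eq_plus1)
    then show "(\<phi> has_real_derivative deriv01 \<phi> t) (at t within {0..1})" if "t \<in> {0..1}" for t
      using that by (intro has_deriv01_if_differentiable) (simp add: differentiable_on_def)
  qed (use assms in auto)
  define n d e \<mu> q where "n = frac_order \<alpha>" and "d = deriv01 \<phi> 1" and "e = P \<eta>"
    and "\<mu> = (\<alpha> - 1) * d * L powr (\<alpha> - 2) - \<beta> * e powr (\<alpha> - 1)" and "q = sup_norm01 g"
  have n: "real n - 1 \<le> \<alpha>" "\<alpha> < real n"
    unfolding n_def using assms(1) by (intro frac_order_bounds; simp)+
  have \<eta>: "\<eta> \<in> {0..1}" using assms(4,5) by simp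
  have e: "0 < e" "e \<le> L" "e \<in> {0..L}"
    using P_less[of 0 \<eta>] P_in[OF \<eta>] P_0 \<eta> assms(4) by (auto simp: e_def)
  have d: "d > 0" unfolding d_def by (rule deriv_pos) simp
  have "\<phi> 1 \<in> {0..1}" "\<phi> 0 \<in> {0..1}"
    by (rule subsetD[OF assms(6)], rule imageI, simp)+
  then have L1: "L \<le> 1" by (simp add: Phi_def)
  have G: "Gamma \<alpha> > 0" using assms(1) by (intro Gamma_real_pos) simp
  define A where "A = L powr (\<alpha> - 1)"
  have A: "0 < A" "A \<le> 1" unfolding A_def using L_pos L1 assms(1) powr_le1[of "\<alpha> - 1" L] by auto
  have q: "q \<ge> 0" unfolding q_def using abs_le_sup_norm01[OF assms(11), of 0] by simp
  have bound: "q < \<mu> * Gamma \<alpha> / (sqrt 2 * A * d)"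
    using assms(15) by (simp add: mu_const_def q_def \<mu>_def d_def e_def A_def)
  have D: "0 < sqrt 2 * A * d" using A d by simp
  have qD: "q * (sqrt 2 * A * d) < \<mu> * Gamma \<alpha>" using bound D by (simp add: pos_less_divide_eq)
  have "0 \<le> q * (sqrt 2 * A * d)" using q D by simp
  then have "0 < \<mu> * Gamma \<alpha>" using qD by linarith
  \<comment> \<open>A supremum norm is nonnegative, so the bound on \<open>g\<close> also forces \<open>\<mu>\<close> to be positive.\<close>
  then have mu: "\<mu> > 0" using G zero_less_mult_pos2 by blast
  \<comment> \<open>As \<open>\<phi>\<close> maps into \<open>[0, 1]\<close>, \<open>A \<le> 1 < sqrt 2\<close>; this brings the bound on \<open>g\<close> to the contraction constant.\<close>
  have "q * (d * A * A) \<le> q * (sqrt 2 * A * d)"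
  proof (rule mult_left_mono[OF _ q])
    have "A \<le> sqrt 2" using A(2) real_sqrt_ge_one[of 2] by linarith
    then have "A * (A * d) \<le> sqrt 2 * (A * d)" using A d by (intro mult_right_mono) auto
    then show "d * A * A \<le> sqrt 2 * A * d" by (simp add: mult_ac)
  qed
  then have "q * (d * A * A) < \<mu> * Gamma \<alpha>" using qD by linarith
  then have small: "q * (d * L powr (\<alpha> - 1) * L powr (\<alpha> - 1) / (\<mu> * Gamma \<alpha>)) < 1"
    using \<open>0 < \<mu> * Gamma \<alpha>\<close> unfolding A_def[symmetric] by simp
  define F where "F = (\<lambda>x. f (Q x))"
  have Fc: "continuous_on ({0..L} \<times> UNIV) (\<lambda>(x, a). F x a)"
  proof -
    have "continuous_on ({0..L} \<times> (UNIV::real set)) (\<lambda>p. (Q (fst p), snd p))"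
      by (intro continuous_intros continuous_on_compose2[OF Q_continuous]) auto
    moreover have "(\<lambda>p. (Q (fst p), snd p)) ` ({0..L} \<times> (UNIV::real set)) \<subseteq> {0..1} \<times> UNIV"
      using Q_in by (intro image_subsetI) (simp add: mem_Times_iff)
    ultimately show ?thesis
      using continuous_on_compose2[OF assms(10)] by (fastforce simp: F_def split_def)
  qed
  have Flip: "\<bar>F x a - F x b\<bar> \<le> q * \<bar>a - b\<bar>" if x: "x \<in> {0..L}" for x a b
  proof -
    have "\<bar>F x a - F x b\<bar> \<le> g (Q x) * \<bar>a - b\<bar>" using assms(14) Q_in[OF x] by (simp add: F_def)
    also have "\<dots> \<le> q * \<bar>a - b\<bar>"
      using abs_le_sup_norm01[OF assms(11) Q_in[OF x]] unfolding q_def by (intro mult_right_mono) auto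
    finally show ?thesis .
  qed
  note params = assms(1,2) n L_pos e(1,2) d \<mu>_def
  define T where "T = (\<lambda>v. green_solution \<alpha> \<beta> d e L (\<lambda>s. F s (v s)))"
  obtain v where v: "continuous_on {0..L} v" "\<And>x. x \<in> {0..L} \<Longrightarrow> T v x = v x"
    and unique: "\<And>w x. continuous_on {0..L} w \<Longrightarrow> (\<And>x. x \<in> {0..L} \<Longrightarrow> T w x = w x) \<Longrightarrow> x \<in> {0..L} \<Longrightarrow> w x = v x"
    using green_nonlinear_fixpoint[OF params assms(3) mu Fc Flip q small] unfolding T_def by blast
  have mu': "\<mu> \<noteq> 0" using mu by simp
  have wQ: "continuous_on {0..L} (\<lambda>x. w (Q x))" if "continuous_on {0..1} w" for w
    by (rule continuous_on_compose2[OF that Q_continuous]) (use Q_in in auto)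
  have Fw: "continuous_on {0..L} (\<lambda>x. F x (w x))" if w: "continuous_on {0..L} w" for w
  proof -
    have "continuous_on {0..L} (\<lambda>x. (x, w x))" by (intro continuous_intros w)
    from continuous_on_compose2[OF Fc this] show ?thesis by auto
  qed
  have sol: "bvp_solution \<alpha> \<beta> \<eta> \<phi> f w \<longleftrightarrow> (\<forall>x\<in>{0..L}. T (\<lambda>x. w (Q x)) x = w (Q x))"
    if w: "continuous_on {0..1} w" for w
  proof -
    have "bvp_solution \<alpha> \<beta> \<eta> \<phi> f w \<longleftrightarrow> rl_bvp \<alpha> n \<beta> d e L (\<lambda>x. F x (w (Q x))) (\<lambda>x. w (Q x))"
      using bvp_solution_iff_rl_bvp[OF w _ \<eta>] n by (simp add: n_def d_def e_def F_def)
    also have "\<dots> \<longleftrightarrow> (\<forall>x\<in>{0..L}. T (\<lambda>x. w (Q x)) x = w (Q x))"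
      unfolding T_def
    proof (intro iffI ballI)
      fix x assume "rl_bvp \<alpha> n \<beta> d e L (\<lambda>x. F x (w (Q x))) (\<lambda>x. w (Q x))" "x \<in> {0..L}"
      then show "green_solution \<alpha> \<beta> d e L (\<lambda>s. F s (w (Q s))) x = w (Q x)"
        by (rule rl_bvp_imp_green[OF params Fw[OF wQ[OF w]] mu', symmetric])
    next
      assume "\<forall>x\<in>{0..L}. green_solution \<alpha> \<beta> d e L (\<lambda>s. F s (w (Q s))) x = w (Q x)"
      then show "rl_bvp \<alpha> n \<beta> d e L (\<lambda>x. F x (w (Q x))) (\<lambda>x. w (Q x))"
        by (intro green_imp_rl_bvp[OF params Fw[OF wQ[OF w]] mu']) simp
    qed
    finally show ?thesis .
  qed
  define u where "u = (\<lambda>t. v (P t))"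
  have u: "continuous_on {0..1} u"
    unfolding u_def by (rule continuous_on_compose2[OF v(1) P_continuous]) (use P_in in auto)
  have uQ: "u (Q x) = v x" if "x \<in> {0..L}" for x using P_Q[OF that] by (simp add: u_def)
  have "T (\<lambda>x. u (Q x)) x = u (Q x)" if x: "x \<in> {0..L}" for x
  proof -
    have "T (\<lambda>x. u (Q x)) x = T v x"
      unfolding T_def by (rule green_cong) (use uQ e x in auto)
    then show ?thesis using v(2)[OF x] uQ[OF x] by simp
  qed
  then have "bvp_solution \<alpha> \<beta> \<eta> \<phi> f u" using sol[OF u] by blast
  moreover have "w t = u t" if w: "bvp_solution \<alpha> \<beta> \<eta> \<phi> f w" and t: "t \<in> {0..1}" for w t
  proof -
    have wc: "continuous_on {0..1} w" using w by (simp add: bvp_solution_def)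
    have "w (Q (P t)) = v (P t)"
      using unique[OF wQ[OF wc] _ P_in[OF t]] w sol[OF wc] by blast
    then show ?thesis using Q_P[OF t] by (simp add: u_def)
  qed
  ultimately show ?thesis by blast
qed

end
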